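(* Let $\Gamma$ be a countable group with an infinite subgroup $H\subset\Gamma$. For $i=1,2$, let $H\curvearrowright^{\sigma_i}X_i$ be a free ergodic pmp action and denote by $\Gamma\curvearrowright^{\tilde\sigma_i}\tilde X_i$ its corresponding co-induction to $\Gamma$. If $H\curvearrowright^{\sigma_1}X_1$ is weakly conjugate to $H\curvearrowright^{\sigma_2}X_2$, then $\Gamma\curvearrowright^{\tilde\sigma_1}\tilde X_1$ is weakly conjugate to $\Gamma\curvearrowright^{\tilde\sigma_2}\tilde X_2$.
   Context: Probability spaces are standard; pmp means probability measure preserving. A pmp action $G\curvearrowright^\sigma(X,\mu)$ induces an action on $L^\infty(X)$, still denoted $\sigma$, by $\sigma_g(a)(t)=a(\sigma_{g^{-1}}(t))$; $\tau$ denotes integration. Weak conjugacy: a pmp action $G\curvearrowright^\sigma X$ is weakly embeddable into a pmp action $\Lambda\curvearrowright^\rho Y$ with respect to some group isomorphism $\delta:G\simeq\Lambda$ if for any finite $F\subset G$, any projections $p_1,\dots,p_n\in L^\infty(X)$, any $K\ge1$ and any $\varepsilon>0$ there are projections $q_1,\dots,q_n\in L^\infty(Y)$ such that $|\tau(\prod_{i=1}^k\sigma_{g_i}(p_{n_i}))-\tau(\prod_{i=1}^k\rho_{\delta(g_i)}(q_{n_i}))|<\varepsilon$ for all $1\le k\le K$, $g_1,\dots,g_k\in F$, $1\le n_1,\dots,n_k\le n$. The two actions are weakly conjugate if each one of them is weakly embeddable into the other, with respect to the same group isomorphism (that is, for some isomorphism $\delta:G\simeq\Lambda$, $\sigma$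 embeds weakly into $\rho$ with respect to $\delta$ and $\rho$ into $\sigma$ with respect to $\delta^{-1}$). Co-induction: let $H\subset\Gamma$ and let $H\curvearrowright^\sigma(A,\tau)$ be the trace preserving action on $A=L^\infty(X)$ given by a pmp action on $X$. Let $S\subset\Gamma$ be a set of representatives of $\Gamma/H$, define $\pi:\Gamma\to H$ by $\pi(sh)=h$ ($s\in S$, $h\in H$) and $c:\Gamma\times(\Gamma/H)\to H$ by $c(g,sH)=\pi(gs)\pi(s)^{-1}$, $s\in S$, $g\in\Gamma$. On $\tilde A=A^{\overline\otimes\,\Gamma/H}=L^\infty(\tilde X)$, $\tilde X=X^{\Gamma/H}$, write $\tilde a_{sH}$ for the elementary tensor with $a\in A$ in position $sH$ and $1$ elsewhere. The co-induction of $\sigma$ from $H$ to $\Gamma$ is the action $\tilde\sigma$ of $\Gamma$ on $\tilde A$ (equivalently on $\tilde X$) determined by $\tilde\sigma_g(\tilde a_{sH})=\tilde b_{gsH}$ with $b=\sigma_{c(g,sH)}(a)$.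
   Formalization: The isomorphism of H giving the weak conjugacy is assumed to extend to an automorphism of Γ, and the co-inductions are weakly conjugate with respect to it; for an arbitrary isomorphism of H the claim fails (the identity is covered). *)

theory Defs
  imports "HOL-Probability.Probability" "HOL-Algebra.Left_Coset"
begin

definition standard_prob_space :: "'x measure \<Rightarrow> bool" where
  "standard_prob_space M \<longleftrightarrow> prob_space M \<and>
     (\<exists>T. completely_metrizable_space T \<and> separable_space T \<and> topspace T = space M \<and>
          sets M = sigma_sets (space M) {U. openin T U})"

definition pmp_action :: "('g, 'm) monoid_scheme \<Rightarrow> 'x measure \<Rightarrow> ('g \<Rightarrow> 'x \<Rightarrow> 'x) \<Rightarrow> bool" where
  "pmp_action G M \<sigma> \<longleftrightarrow>
     (\<forall>g\<in>carrier G. \<sigma> g \<in> measurable M M \<and> distr M M (\<sigma> g) = M) \<and>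
     (\<forall>x\<in>space M. \<sigma> \<one>\<^bsub>G\<^esub> x = x) \<and>
     (\<forall>g\<in>carrier G. \<forall>h\<in>carrier G. \<forall>x\<in>space M. \<sigma> (g \<otimes>\<^bsub>G\<^esub> h) x = \<sigma> g (\<sigma> h x))"

definition free_action :: "('g, 'm) monoid_scheme \<Rightarrow> 'x measure \<Rightarrow> ('g \<Rightarrow> 'x \<Rightarrow> 'x) \<Rightarrow> bool" where
  "free_action G M \<sigma> \<longleftrightarrow> (\<forall>g\<in>carrier G - {\<one>\<^bsub>G\<^esub>}. AE x in M. \<sigma> g x \<noteq> x)"

definition ergodic_action :: "('g, 'm) monoid_scheme \<Rightarrow> 'x measure \<Rightarrow> ('g \<Rightarrow> 'x \<Rightarrow> 'x) \<Rightarrow> bool" where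
  "ergodic_action G M \<sigma> \<longleftrightarrow>
     (\<forall>A\<in>sets M. (\<forall>g\<in>carrier G. AE x in M. \<sigma> g x \<in> A \<longleftrightarrow> x \<in> A) \<longrightarrow>
        measure M A = 0 \<or> measure M A = 1)"

text \<open>Elements of \<open>L\<^sup>\<infinity>\<close> are represented by functions; everything below is
  insensitive to changing a representative on a null set.\<close>

definition Linfty :: "'x measure \<Rightarrow> ('x \<Rightarrow> complex) set" where
  "Linfty M = {a \<in> borel_measurable M. \<exists>C. AE x in M. cmod (a x) \<le> C}"

definition projections :: "'x measure \<Rightarrow> ('x \<Rightarrow> complex) set" where
  "projections M = {p \<in> Linfty M. AE x in M. p x * p x = p x \<and> cnj (p x) = p x}"

definition koopman ::
  "('g, 'm) monoid_scheme \<Rightarrow> ('g \<Rightarrow> 'x \<Rightarrow> 'x) \<Rightarrow> 'g \<Rightarrow> ('x \<Rightarrow> complex) \<Rightarrow> 'x \<Rightarrow> complex" where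
  "koopman G \<sigma> g a = (\<lambda>t. a (\<sigma> (inv\<^bsub>G\<^esub> g) t))"

definition weakly_embeddable ::
  "('g, 'm) monoid_scheme \<Rightarrow> 'x measure \<Rightarrow> ('g \<Rightarrow> 'x \<Rightarrow> 'x) \<Rightarrow>
   ('l, 'k) monoid_scheme \<Rightarrow> 'y measure \<Rightarrow> ('l \<Rightarrow> 'y \<Rightarrow> 'y) \<Rightarrow> ('g \<Rightarrow> 'l) \<Rightarrow> bool" where
  "weakly_embeddable G M \<sigma> \<Lambda> N \<rho> \<delta> \<longleftrightarrow>
     \<delta> \<in> iso G \<Lambda> \<and>
     (\<forall>F (n::nat) p (K::nat) (\<epsilon>::real).
        finite F \<and> F \<subseteq> carrier G \<and> (\<forall>j\<in>{1..n}. p j \<in> projections M) \<and> K \<ge> 1 \<and> \<epsilon> > 0 \<longrightarrow>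
        (\<exists>q. (\<forall>j\<in>{1..n}. q j \<in> projections N) \<and>
          (\<forall>k\<in>{1..K}. \<forall>g m. (\<forall>i\<in>{1..k}. g i \<in> F \<and> m i \<in> {1..n}) \<longrightarrow>
             cmod ((LINT x|M. (\<Prod>i=1..k. koopman G \<sigma> (g i) (p (m i)) x)) -
                   (LINT y|N. (\<Prod>i=1..k. koopman \<Lambda> \<rho> (\<delta> (g i)) (q (m i)) y))) < \<epsilon>)))"

definition weakly_conjugate ::
  "('g, 'm) monoid_scheme \<Rightarrow> 'x measure \<Rightarrow> ('g \<Rightarrow> 'x \<Rightarrow> 'x) \<Rightarrow>
   ('l, 'k) monoid_scheme \<Rightarrow> 'y measure \<Rightarrow> ('l \<Rightarrow> 'y \<Rightarrow> 'y) \<Rightarrow> ('g \<Rightarrow> 'l) \<Rightarrow> bool" where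
  "weakly_conjugate G M \<sigma> \<Lambda> N \<rho> \<delta> \<longleftrightarrow>
     weakly_embeddable G M \<sigma> \<Lambda> N \<rho> \<delta> \<and>
     weakly_embeddable \<Lambda> N \<rho> G M \<sigma> (inv_into (carrier G) \<delta>)"

definition coset_reps :: "('g, 'm) monoid_scheme \<Rightarrow> 'g set \<Rightarrow> 'g set \<Rightarrow> bool" where
  "coset_reps G H S \<longleftrightarrow> S \<subseteq> carrier G \<and> (\<forall>C\<in>lcosets\<^bsub>G\<^esub> H. \<exists>!s. s \<in> S \<and> s \<in> C)"

definition coset_rep :: "'g set \<Rightarrow> 'g set \<Rightarrow> 'g" where
  "coset_rep S C = (THE s. s \<in> S \<and> s \<in> C)"

definition coset_pi :: "('g, 'm) monoid_scheme \<Rightarrow> 'g set \<Rightarrow> 'g set \<Rightarrow> 'g \<Rightarrow> 'g" where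
  "coset_pi G H S g = (THE h. h \<in> H \<and> (\<exists>s\<in>S. g = s \<otimes>\<^bsub>G\<^esub> h))"

definition coset_cocycle :: "('g, 'm) monoid_scheme \<Rightarrow> 'g set \<Rightarrow> 'g set \<Rightarrow> 'g \<Rightarrow> 'g set \<Rightarrow> 'g" where
  "coset_cocycle G H S g C =
     coset_pi G H S (g \<otimes>\<^bsub>G\<^esub> coset_rep S C) \<otimes>\<^bsub>G\<^esub> inv\<^bsub>G\<^esub> (coset_pi G H S (coset_rep S C))"

definition coind_space :: "('g, 'm) monoid_scheme \<Rightarrow> 'g set \<Rightarrow> 'x measure \<Rightarrow> ('g set \<Rightarrow> 'x) measure" where
  "coind_space G H M = (\<Pi>\<^sub>M C\<in>lcosets\<^bsub>G\<^esub> H. M)"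

text \<open>The point action on \<open>X\<close> to the power \<open>G/H\<close> whose induced action on functions is the
  co-induction; the lemma \<open>koopman_coind_action\<close> below is the formula determining it on
  elementary tensors.\<close>

definition coind_action ::
  "('g, 'm) monoid_scheme \<Rightarrow> 'g set \<Rightarrow> 'g set \<Rightarrow> ('g \<Rightarrow> 'x \<Rightarrow> 'x) \<Rightarrow>
   'g \<Rightarrow> ('g set \<Rightarrow> 'x) \<Rightarrow> ('g set \<Rightarrow> 'x)" where
  "coind_action G H S \<sigma> g t =
     (\<lambda>C\<in>lcosets\<^bsub>G\<^esub> H.
        \<sigma> (coset_cocycle G H S g (inv\<^bsub>G\<^esub> g <#\<^bsub>G\<^esub> C)) (t (inv\<^bsub>G\<^esub> g <#\<^bsub>G\<^esub> C)))"

definition elementary_tensor :: "'g set \<Rightarrow> ('x \<Rightarrow> complex) \<Rightarrow> ('g set \<Rightarrow> 'x) \<Rightarrow> complex" where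
  "elementary_tensor C a = (\<lambda>t. a (t C))"

lemma coset_rep_eq:
  assumes "Group.group G" "subgroup H G" "coset_reps G H S" "s \<in> S" "h \<in> H"
  shows "coset_rep S (s <#\<^bsub>G\<^esub> H) = s"
    and "coset_pi G H S (s \<otimes>\<^bsub>G\<^esub> h) = h"
proof -
  interpret Group.group G by fact
  interpret subgroup H G by fact
  have sG: "s \<in> carrier G" using assms by (auto simp: coset_reps_def)
  have mem: "s' \<in> S \<Longrightarrow> s' \<in> s' <#\<^bsub>G\<^esub> H" for s'
    using assms by (auto simp: coset_reps_def intro: lcos_self)
  have C: "s <#\<^bsub>G\<^esub> H \<in> lcosets\<^bsub>G\<^esub> H" using sG by (auto simp: LCOSETS_def)
  have uniq: "s' = s" if "s' \<in> S" "s' \<in> s <#\<^bsub>G\<^esub> H" for s'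
    using assms C that mem by (auto simp: coset_reps_def)
  show "coset_rep S (s <#\<^bsub>G\<^esub> H) = s"
    unfolding coset_rep_def using uniq mem assms(4) by (intro the_equality) auto
  show "coset_pi G H S (s \<otimes>\<^bsub>G\<^esub> h) = h"
    unfolding coset_pi_def
  proof (rule the_equality)
    show "h \<in> H \<and> (\<exists>s'\<in>S. s \<otimes>\<^bsub>G\<^esub> h = s' \<otimes>\<^bsub>G\<^esub> h)" using assms by auto
    fix k assume k: "k \<in> H \<and> (\<exists>s'\<in>S. s \<otimes>\<^bsub>G\<^esub> h = s' \<otimes>\<^bsub>G\<^esub> k)"
    then obtain s' where s': "s' \<in> S" "s \<otimes>\<^bsub>G\<^esub> h = s' \<otimes>\<^bsub>G\<^esub> k" by auto
    have s'G: "s' \<in> carrier G" using s' assms by (auto simp: coset_reps_def)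
    have "s' = s \<otimes>\<^bsub>G\<^esub> (h \<otimes>\<^bsub>G\<^esub> inv\<^bsub>G\<^esub> k)"
      using s'(2) s'G sG k assms(5) by (simp add: m_assoc[symmetric] inv_solve_right)
    then have "s' \<in> s <#\<^bsub>G\<^esub> H" using k assms(5) by (auto simp: l_coset_def)
    then have "s' = s" using uniq s' by blast
    then show "k = h" using s'(2) sG k assms(5) by simp
  qed
qed

lemma koopman_coind_action:
  assumes "Group.group G" "subgroup H G" "coset_reps G H S"
    and g: "g \<in> carrier G" and s: "s \<in> S"
  shows "koopman G (coind_action G H S \<sigma>) g (elementary_tensor (s <#\<^bsub>G\<^esub> H) a) =
         elementary_tensor ((g \<otimes>\<^bsub>G\<^esub> s) <#\<^bsub>G\<^esub> H)
           (koopman (G\<lparr>carrier := H\<rparr>) \<sigma> (coset_cocycle G H S g (s <#\<^bsub>G\<^esub> H)) a)"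
proof -
  interpret Group.group G by fact
  interpret subgroup H G by fact
  have sG: "s \<in> carrier G" using assms by (auto simp: coset_reps_def)
  have C: "s <#\<^bsub>G\<^esub> H \<in> lcosets\<^bsub>G\<^esub> H" using sG by (auto simp: LCOSETS_def)
  have D: "(g \<otimes>\<^bsub>G\<^esub> s) <#\<^bsub>G\<^esub> H \<in> lcosets\<^bsub>G\<^esub> H" using sG g by (auto simp: LCOSETS_def)
  obtain s' where s': "s' \<in> S" "s' \<in> (g \<otimes>\<^bsub>G\<^esub> s) <#\<^bsub>G\<^esub> H"
    using assms(3) D by (auto simp: coset_reps_def)
  then obtain h where h: "h \<in> H" "s' = g \<otimes>\<^bsub>G\<^esub> s \<otimes>\<^bsub>G\<^esub> h" by (auto simp: l_coset_def)
  have s'G: "s' \<in> carrier G" using s' assms by (auto simp: coset_reps_def)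
  have D': "(g \<otimes>\<^bsub>G\<^esub> s) <#\<^bsub>G\<^esub> H = s' <#\<^bsub>G\<^esub> H"
    using l_repr_independence[of s' "g \<otimes>\<^bsub>G\<^esub> s" H] s' sG g subgroup_axioms by auto
  have gs: "g \<otimes>\<^bsub>G\<^esub> s = s' \<otimes>\<^bsub>G\<^esub> inv\<^bsub>G\<^esub> h"
    using h g sG by (simp add: inv_solve_right)
  have gs': "inv\<^bsub>G\<^esub> g \<otimes>\<^bsub>G\<^esub> s' = s \<otimes>\<^bsub>G\<^esub> h"
    using h g sG by (simp add: m_assoc[symmetric])
  note rep = coset_rep_eq[OF assms(1-3)]
  have pi1: "coset_pi G H S r = \<one>\<^bsub>G\<^esub>" if "r \<in> S" for r
    using rep(2)[OF that one_closed] that assms(3) by (auto simp: coset_reps_def subset_eq)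
  have c1: "coset_cocycle G H S g (s <#\<^bsub>G\<^esub> H) = inv\<^bsub>G\<^esub> h"
    using rep(1)[OF s one_closed] rep(2)[OF s'(1), of "inv\<^bsub>G\<^esub> h"] pi1[OF s] gs h(1)
    by (simp add: coset_cocycle_def)
  have c2: "coset_cocycle G H S (inv\<^bsub>G\<^esub> g) (s' <#\<^bsub>G\<^esub> H) = h"
    using rep(1)[OF s'(1) one_closed] rep(2)[OF s h(1)] pi1[OF s'(1)] gs' h(1)
    by (simp add: coset_cocycle_def)
  have gC: "g <#\<^bsub>G\<^esub> (s <#\<^bsub>G\<^esub> H) = s' <#\<^bsub>G\<^esub> H"
    using D' lcos_m_assoc[of H g s] g sG subset by simp
  show ?thesis
    using C c1 c2 gC g h(1) D' subgroup_axioms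
    by (simp add: fun_eq_iff koopman_def elementary_tensor_def coind_action_def m_inv_consistent)
qed

end

theory Submission
  imports Defs
begin

text \<open>Weak embeddability says that finite families of sets in the first space have copies in the
  second with almost the same joint distribution of translates. It passes to co-inductions because
  a co-induction is built from independent copies of the base action, one for each coset.

  To make this precise without cocycles, a point \<open>t\<close> of \<open>X\<close> to the power \<open>\<Gamma>/H\<close> is extended to an
  \<open>H\<close>-equivariant function \<open>\<gamma> \<mapsto> ev \<gamma> t\<close> from \<open>\<Gamma>\<close> to \<open>X\<close>. The co-induced action becomes left
  translation of such functions, and values at elements of distinct cosets are independent, each
  distributed as \<open>X\<close> (lemmas \<open>ev_mult\<close>, \<open>ev_coind_action\<close>, \<open>measure_ev_joint\<close>).

  Given finitely many sets in the first co-induced space, approximate them by Boolean combinations of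
  finitely many conditions \<open>ev \<gamma> t \<in> A\<close> (\<open>approximable_by_pattern_event\<close>). Weak embeddability of the
  base action provides copies \<open>\<Phi> A\<close> of the sets \<open>A\<close>; in the second space take the same Boolean combinations
  of the conditions \<open>ev (\<Delta> \<gamma>) t \<in> \<Phi> A\<close>. The probability that several conditions hold at once is a
  product over cosets of moments of the base action, hence almost unchanged
  (\<open>evaluation_moment_diff_le\<close>). Inclusion-exclusion carries this over to all Boolean combinations
  (\<open>pattern_event_measure_diff_le\<close>), in particular to intersections of translates of the chosen sets.
  This proves one weak embedding (\<open>weakly_embeddable_coind\<close>), and the other follows by exchanging
  the two actions and inverting the isomorphism.\<close>

section \<open>Boolean combinations of finitely many events\<close>

text \<open>Every event in the finite algebra generated by the sets \<open>W i\<close>, \<open>i \<in> E\<close>, is a condition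
  on which of these sets contain the point. The subset of \<open>E\<close> recording this is the
  pattern of the point, and \<open>P\<close> plays the role of a Boolean formula in the generators. The same
  formula can then be read in another space, with other sets for the same indices.\<close>

definition pattern_event :: "'a measure \<Rightarrow> ('i \<Rightarrow> 'a set) \<Rightarrow> 'i set \<Rightarrow> ('i set \<Rightarrow> bool) \<Rightarrow> 'a set" where
  "pattern_event M W E P = {x\<in>space M. P {i\<in>E. x \<in> W i}}"

lemma pattern_event_decompose:
  "pattern_event M W E P =
     (\<Union>Z\<in>{Z\<in>Pow E. P Z}. {x\<in>space M. (\<forall>i\<in>Z. x \<in> W i) \<and> (\<forall>i\<in>E - Z. x \<notin> W i)})"
  (is "?L = ?R")
proof (intro equalityI subsetI)
  fix x assume "x \<in> ?L"
  then show "x \<in> ?R"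
    by (auto simp: pattern_event_def intro!: exI[of _ "{i\<in>E. x \<in> W i}"])
next
  fix x assume "x \<in> ?R"
  then obtain Z where Z: "Z \<subseteq> E" "P Z" "x \<in> space M" "\<forall>i\<in>Z. x \<in> W i" "\<forall>i\<in>E - Z. x \<notin> W i"
    by auto
  then have "{i\<in>E. x \<in> W i} = Z" by auto
  with Z show "x \<in> ?L" by (simp add: pattern_event_def)
qed

lemma sets_pattern_event:
  assumes "finite E" and W: "\<And>i. i \<in> E \<Longrightarrow> W i \<in> sets M"
  shows "pattern_event M W E P \<in> sets M"
  unfolding pattern_event_decompose
proof (intro sets.finite_UN)
  show "finite {Z\<in>Pow E. P Z}" using assms by simp
  fix Z assume "Z \<in> {Z\<in>Pow E. P Z}"
  then have Z: "Z \<subseteq> E" "finite Z" "finite (E - Z)"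
    using assms by (auto intro: finite_subset)
  have "{x\<in>space M. x \<in> W i} \<in> sets M" if "i \<in> E" for i
    using sets.Int_space_eq1[OF W[OF that]] W[OF that] by (simp add: Int_def)
  then show "{x\<in>space M. (\<forall>i\<in>Z. x \<in> W i) \<and> (\<forall>i\<in>E - Z. x \<notin> W i)} \<in> sets M"
    using Z by (intro sets.sets_Collect_conj sets.sets_Collect_finite_All sets.sets_Collect_neg) auto
qed

text \<open>The Boolean algebra generated by a family is dense, in measure, in the generated
  \<open>\<sigma>\<close>-algebra: the sets that can be approximated are closed under complements, and under countable
  unions because finitely many pieces already exhaust the union up to a small set.\<close>

lemma (in finite_measure) approximable_by_pattern_event:
  assumes gen: "sets M = sigma_sets (space M) (W ` I)"
    and "B \<in> sets M" and "\<epsilon> > 0"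
  shows "\<exists>E P. finite E \<and> E \<subseteq> I \<and> measure M (sym_diff B (pattern_event M W E P)) < \<epsilon>"
proof -
  have W: "W i \<in> sets M" if "i \<in> I" for i
    using that by (auto simp: gen)
  have pat: "pattern_event M W E P \<in> sets M" if "finite E" "E \<subseteq> I" for E P
    using that W by (intro sets_pattern_event) auto
  have "B \<in> sigma_sets (space M) (W ` I)"
    using assms by simp
  then show ?thesis
    using \<open>\<epsilon> > 0\<close>
  proof (induction arbitrary: \<epsilon>)
    case (Basic a)
    then obtain i where i: "i \<in> I" "a = W i" by auto
    have "pattern_event M W {i} (\<lambda>Z. i \<in> Z) = a"
      using sets.sets_into_space[OF W[OF i(1)]] i by (auto simp: pattern_event_def)
    then show ?case
      using i Basic by (intro exI[of _ "{i}"] exI[of _ "\<lambda>Z. i \<in> Z"]) auto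
  next
    case Empty
    then show ?case
      by (intro exI[of _ "{}"] exI[of _ "\<lambda>Z. False"]) (simp add: pattern_event_def)
  next
    case (Compl a)
    obtain E P where E: "finite E" "E \<subseteq> I" "measure M (sym_diff a (pattern_event M W E P)) < \<epsilon>"
      using Compl by blast
    have "sym_diff (space M - a) (pattern_event M W E (\<lambda>Z. \<not> P Z)) =
        sym_diff a (pattern_event M W E P)"
      using Compl.hyps gen sets.sets_into_space[of a M] by (auto simp: pattern_event_def)
    with E show ?case
      by (intro exI[of _ E] exI[of _ "\<lambda>Z. \<not> P Z"]) simp
  next
    case (Union a)
    have a: "a n \<in> sets M" for n
      using Union.hyps by (simp add: gen)
    define U where "U = (\<Union>n. a n)"
    have U: "U \<in> sets M" using a by (auto simp: U_def)
    have "(\<lambda>n. measure M (\<Union>i<n. a i)) \<longlonglongrightarrow> measure M (\<Union>n. \<Union>i<n. a i)"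
      using a by (intro finite_Lim_measure_incseq) (auto simp: incseq_def intro: less_le_trans)
    also have "(\<Union>n. \<Union>i<n. a i) = U"
      by (auto simp: U_def)
    finally have "eventually (\<lambda>n. dist (measure M (\<Union>i<n. a i)) (measure M U) < \<epsilon> / 2) sequentially"
      using Union.prems by (intro tendstoD) auto
    then obtain N where N: "dist (measure M (\<Union>i<N. a i)) (measure M U) < \<epsilon> / 2"
      by (auto simp: eventually_sequentially)
    have "measure M (U - (\<Union>i<N. a i)) = measure M U - measure M (\<Union>i<N. a i)"
      using a U by (intro finite_measure_Diff) (auto simp: U_def)
    then have tail: "measure M (U - (\<Union>i<N. a i)) < \<epsilon> / 2"
      using N unfolding dist_real_def by linarith
    define \<epsilon>' where "\<epsilon>' = \<epsilon> / (2 * (real N + 1))"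
    have "\<epsilon>' > 0" using Union.prems by (simp add: \<epsilon>'_def)
    then have "\<forall>n. \<exists>E P. finite E \<and> E \<subseteq> I \<and> measure M (sym_diff (a n) (pattern_event M W E P)) < \<epsilon>'"
      using Union.IH by blast
    then obtain E P where E: "\<And>n. finite (E n)" "\<And>n. E n \<subseteq> I"
        "\<And>n. measure M (sym_diff (a n) (pattern_event M W (E n) (P n))) < \<epsilon>'"
      by metis
    define E' where "E' = (\<Union>n<N. E n)"
    define P' where "P' = (\<lambda>Z. \<exists>n<N. P n (Z \<inter> E n))"
    have E': "finite E'" "E' \<subseteq> I" using E by (auto simp: E'_def)
    have "{i\<in>E'. x \<in> W i} \<inter> E n = {i\<in>E n. x \<in> W i}" if "n < N" for n x
      using that by (auto simp: E'_def)
    then have patE': "pattern_event M W E' P' = (\<Union>n<N. pattern_event M W (E n) (P n))"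
      by (auto simp: pattern_event_def P'_def)
    define D where "D = (\<lambda>n. sym_diff (a n) (pattern_event M W (E n) (P n)))"
    have D: "D n \<in> sets M" for n using a pat E by (auto simp: D_def)
    have "measure M (sym_diff U (pattern_event M W E' P')) \<le> measure M ((U - (\<Union>i<N. a i)) \<union> (\<Union>n<N. D n))"
    proof (rule finite_measure_mono)
      show "sym_diff U (pattern_event M W E' P') \<subseteq> (U - (\<Union>i<N. a i)) \<union> (\<Union>n<N. D n)"
        unfolding patE' D_def U_def by blast
      show "(U - (\<Union>i<N. a i)) \<union> (\<Union>n<N. D n) \<in> sets M"
        using U a D by auto
    qed
    also have "\<dots> \<le> measure M (U - (\<Union>i<N. a i)) + measure M (\<Union>n<N. D n)"
      using U a D by (intro measure_Un_le) auto
    also have "measure M (\<Union>n<N. D n) \<le> (\<Sum>n<N. measure M (D n))"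
      using D by (intro finite_measure_subadditive_finite) auto
    also have "(\<Sum>n<N. measure M (D n)) \<le> real N * \<epsilon>'"
      using E(3) sum_bounded_above[of "{..<N}" "\<lambda>n. measure M (D n)" \<epsilon>']
      by (auto simp: D_def less_imp_le)
    also have "real N * \<epsilon>' \<le> \<epsilon> / 2"
      using Union.prems by (simp add: \<epsilon>'_def field_simps)
    finally have "measure M (sym_diff U (pattern_event M W E' P')) < \<epsilon>"
      using tail by simp
    with E' show ?case
      unfolding U_def by (intro exI[of _ E'] exI[of _ P']) simp
  qed
qed

text \<open>Excluding one more set costs a factor 2 by inclusion-exclusion: the part of an event outside
  \<open>W j\<close> has the measure of the event minus that of the part inside \<open>W j\<close>.\<close>

lemma mixed_event_measure_diff_le:
  assumes M: "finite_measure M" and N: "finite_measure N"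
    and fin: "finite E" and W: "\<And>i. i \<in> E \<Longrightarrow> W i \<in> sets M" and V: "\<And>i. i \<in> E \<Longrightarrow> V i \<in> sets N"
    and close: "\<And>T. T \<subseteq> E \<Longrightarrow>
      \<bar>measure M {x\<in>space M. \<forall>i\<in>T. x \<in> W i} - measure N {y\<in>space N. \<forall>i\<in>T. y \<in> V i}\<bar> \<le> \<eta>"
    and "finite L" "L \<subseteq> E" "T \<subseteq> E"
  shows "\<bar>measure M {x\<in>space M. (\<forall>i\<in>T. x \<in> W i) \<and> (\<forall>i\<in>L. x \<notin> W i)} -
          measure N {y\<in>space N. (\<forall>i\<in>T. y \<in> V i) \<and> (\<forall>i\<in>L. y \<notin> V i)}\<bar> \<le> 2 ^ card L * \<eta>"
  using \<open>finite L\<close> \<open>L \<subseteq> E\<close> \<open>T \<subseteq> E\<close>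
proof (induction L arbitrary: T)
  case empty
  then show ?case using close by simp
next
  case (insert j L)
  have split: "measure Q {x\<in>space Q. (\<forall>i\<in>T. x \<in> R i) \<and> (\<forall>i\<in>insert j L. x \<notin> R i)} =
      measure Q {x\<in>space Q. (\<forall>i\<in>T. x \<in> R i) \<and> (\<forall>i\<in>L. x \<notin> R i)} -
      measure Q {x\<in>space Q. (\<forall>i\<in>insert j T. x \<in> R i) \<and> (\<forall>i\<in>L. x \<notin> R i)}"
    if Q: "finite_measure Q" and R: "\<And>i. i \<in> E \<Longrightarrow> R i \<in> sets Q"
    for Q :: "'x measure" and R
  proof -
    have meas: "{x\<in>space Q. (\<forall>i\<in>T'. x \<in> R i) \<and> (\<forall>i\<in>L. x \<notin> R i)} \<in> sets Q" if "T' \<subseteq> E" for T'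
    proof -
      have "{x\<in>space Q. (\<forall>i\<in>T'. x \<in> R i) \<and> (\<forall>i\<in>L. x \<notin> R i)} =
          pattern_event Q R E (\<lambda>Z. T' \<subseteq> Z \<and> L \<inter> Z = {})"
        using that insert.prems by (auto simp: pattern_event_def)
      then show ?thesis using sets_pattern_event[OF fin, of R Q] R by simp
    qed
    have "{x\<in>space Q. (\<forall>i\<in>T. x \<in> R i) \<and> (\<forall>i\<in>insert j L. x \<notin> R i)} =
        {x\<in>space Q. (\<forall>i\<in>T. x \<in> R i) \<and> (\<forall>i\<in>L. x \<notin> R i)} -
        {x\<in>space Q. (\<forall>i\<in>insert j T. x \<in> R i) \<and> (\<forall>i\<in>L. x \<notin> R i)}"
      by auto
    then show ?thesis
      using insert.prems meas[of T] meas[of "insert j T"]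
      by (simp only:) (intro finite_measure.finite_measure_Diff[OF Q], auto)
  qed
  have "\<bar>measure M {x\<in>space M. (\<forall>i\<in>T. x \<in> W i) \<and> (\<forall>i\<in>L. x \<notin> W i)} -
          measure N {y\<in>space N. (\<forall>i\<in>T. y \<in> V i) \<and> (\<forall>i\<in>L. y \<notin> V i)}\<bar> \<le> 2 ^ card L * \<eta>"
    and "\<bar>measure M {x\<in>space M. (\<forall>i\<in>insert j T. x \<in> W i) \<and> (\<forall>i\<in>L. x \<notin> W i)} -
          measure N {y\<in>space N. (\<forall>i\<in>insert j T. y \<in> V i) \<and> (\<forall>i\<in>L. y \<notin> V i)}\<bar> \<le> 2 ^ card L * \<eta>"
    using insert.IH[of T] insert.IH[of "insert j T"] insert.prems by simp_all
  moreover have "2 ^ card (insert j L) * \<eta> = 2 * (2 ^ card L * \<eta>)"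
    using insert.hyps by simp
  ultimately show ?case
    using split[OF M, of W, OF W] split[OF N, of V, OF V] by linarith
qed

text \<open>If all joint intersections of two finite families have almost the same measures, then so do
  all Boolean combinations: there are at most \<open>2 ^ card E\<close> patterns, and each of them is a mixed
  event with error at most \<open>2 ^ card E * \<eta>\<close>. The bound does not involve the formula \<open>P\<close>, so one choice
  of sets serves for all formulas at once.\<close>

lemma pattern_event_measure_diff_le:
  assumes M: "finite_measure M" and N: "finite_measure N"
    and fin: "finite E" and W: "\<And>i. i \<in> E \<Longrightarrow> W i \<in> sets M" and V: "\<And>i. i \<in> E \<Longrightarrow> V i \<in> sets N"
    and close: "\<And>T. T \<subseteq> E \<Longrightarrow>
      \<bar>measure M {x\<in>space M. \<forall>i\<in>T. x \<in> W i} - measure N {y\<in>space N. \<forall>i\<in>T. y \<in> V i}\<bar> \<le> \<eta>"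
  shows "\<bar>measure M (pattern_event M W E P) - measure N (pattern_event N V E P)\<bar> \<le> 4 ^ card E * \<eta>"
proof -
  have \<eta>: "\<eta> \<ge> 0" using close[of "{}"] by simp
  define \<Z> where "\<Z> = {Z\<in>Pow E. P Z}"
  have fin\<Z>: "finite \<Z>" using fin by (simp add: \<Z>_def)
  have sum: "measure Q (pattern_event Q R E P) =
      (\<Sum>Z\<in>\<Z>. measure Q {x\<in>space Q. (\<forall>i\<in>Z. x \<in> R i) \<and> (\<forall>i\<in>E - Z. x \<notin> R i)})"
    if Q: "finite_measure Q" and R: "\<And>i. i \<in> E \<Longrightarrow> R i \<in> sets Q"
    for Q :: "'x measure" and R
    unfolding pattern_event_decompose \<Z>_def[symmetric]
  proof (rule finite_measure.finite_measure_finite_Union[OF Q fin\<Z>])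
    have "{x\<in>space Q. (\<forall>i\<in>Z. x \<in> R i) \<and> (\<forall>i\<in>E - Z. x \<notin> R i)} = pattern_event Q R E (\<lambda>Y. Y = Z)"
      if "Z \<in> \<Z>" for Z
      using that by (auto simp: pattern_event_def \<Z>_def)
    then show "(\<lambda>Z. {x\<in>space Q. (\<forall>i\<in>Z. x \<in> R i) \<and> (\<forall>i\<in>E - Z. x \<notin> R i)}) ` \<Z> \<subseteq> sets Q"
      using sets_pattern_event[OF fin, of R Q] R by auto
    show "disjoint_family_on (\<lambda>Z. {x\<in>space Q. (\<forall>i\<in>Z. x \<in> R i) \<and> (\<forall>i\<in>E - Z. x \<notin> R i)}) \<Z>"
      by (auto simp: disjoint_family_on_def \<Z>_def)
  qed
  have "\<bar>measure M (pattern_event M W E P) - measure N (pattern_event N V E P)\<bar> \<le>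
      (\<Sum>Z\<in>\<Z>. \<bar>measure M {x\<in>space M. (\<forall>i\<in>Z. x \<in> W i) \<and> (\<forall>i\<in>E - Z. x \<notin> W i)} -
          measure N {y\<in>space N. (\<forall>i\<in>Z. y \<in> V i) \<and> (\<forall>i\<in>E - Z. y \<notin> V i)}\<bar>)"
    by (simp only: sum[OF M W] sum[OF N V] sum_subtractf[symmetric] sum_abs)
  also have "\<dots> \<le> (\<Sum>Z\<in>\<Z>. 2 ^ card E * \<eta>)"
  proof (rule sum_mono)
    fix Z assume Z: "Z \<in> \<Z>"
    have "\<bar>measure M {x\<in>space M. (\<forall>i\<in>Z. x \<in> W i) \<and> (\<forall>i\<in>E - Z. x \<notin> W i)} -
          measure N {y\<in>space N. (\<forall>i\<in>Z. y \<in> V i) \<and> (\<forall>i\<in>E - Z. y \<notin> V i)}\<bar> \<le> 2 ^ card (E - Z) * \<eta>"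
      using Z fin by (intro mixed_event_measure_diff_le[OF M N fin W V close]) (auto simp: \<Z>_def)
    also have "\<dots> \<le> 2 ^ card E * \<eta>"
      using fin \<eta> by (intro mult_right_mono power_increasing card_mono) auto
    finally show "\<bar>measure M {x\<in>space M. (\<forall>i\<in>Z. x \<in> W i) \<and> (\<forall>i\<in>E - Z. x \<notin> W i)} -
          measure N {y\<in>space N. (\<forall>i\<in>Z. y \<in> V i) \<and> (\<forall>i\<in>E - Z. y \<notin> V i)}\<bar> \<le> 2 ^ card E * \<eta>" .
  qed
  also have "\<dots> = real (card \<Z>) * (2 ^ card E * \<eta>)" by simp
  also have "\<dots> \<le> 2 ^ card E * (2 ^ card E * \<eta>)"
  proof (rule mult_right_mono)
    have "card \<Z> \<le> card (Pow E)" using fin by (intro card_mono) (auto simp: \<Z>_def)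
    then show "real (card \<Z>) \<le> 2 ^ card E" using fin by (simp add: card_Pow)
  qed (use \<eta> in simp)
  also have "\<dots> = 4 ^ card E * \<eta>"
    by (simp add: power_mult_distrib[symmetric] mult.assoc[symmetric])
  finally show ?thesis .
qed

lemma (in finite_measure) abs_measure_diff_le_sym_diff:
  assumes "A \<in> sets M" "B \<in> sets M"
  shows "\<bar>measure M A - measure M B\<bar> \<le> measure M (sym_diff A B)"
proof -
  have "measure M A \<le> measure M (B \<union> sym_diff A B)" "measure M B \<le> measure M (A \<union> sym_diff A B)"
    using assms by (auto intro!: finite_measure_mono)
  moreover have "measure M (B \<union> sym_diff A B) \<le> measure M B + measure M (sym_diff A B)"
    "measure M (A \<union> sym_diff A B) \<le> measure M A + measure M (sym_diff A B)"
    using assms by (auto intro!: measure_Un_le)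
  ultimately show ?thesis by linarith
qed

section \<open>Weak embeddability in terms of measurable sets\<close>

text \<open>The property of a pmp action that carries null sets and integrals over to translates, one
  group element at a time.\<close>

definition measure_preserving_maps :: "'g set \<Rightarrow> 'x measure \<Rightarrow> ('g \<Rightarrow> 'x \<Rightarrow> 'x) \<Rightarrow> bool" where
  "measure_preserving_maps A M \<sigma> \<longleftrightarrow> (\<forall>g\<in>A. \<sigma> g \<in> measurable M M \<and> distr M M (\<sigma> g) = M)"

lemma measure_preserving_mapsD:
  assumes "measure_preserving_maps A M \<sigma>" "g \<in> A"
  shows "\<sigma> g \<in> measurable M M" "distr M M (\<sigma> g) = M"
  using assms by (auto simp: measure_preserving_maps_def)

lemma pmp_action_measure_preserving:
  "pmp_action G M \<sigma> \<Longrightarrow> measure_preserving_maps (carrier G) M \<sigma>"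
  by (simp add: pmp_action_def measure_preserving_maps_def)

text \<open>The event \<open>\<Inter>{gA | (g, A) \<in> T}\<close>, with \<open>gA\<close> written as a preimage under \<open>g\<inverse>\<close>.\<close>

definition translates_event ::
  "('g, 'm) monoid_scheme \<Rightarrow> 'x measure \<Rightarrow> ('g \<Rightarrow> 'x \<Rightarrow> 'x) \<Rightarrow> ('g \<times> 'x set) set \<Rightarrow> 'x set" where
  "translates_event G M \<sigma> T = {x\<in>space M. \<forall>(g, A)\<in>T. \<sigma> (inv\<^bsub>G\<^esub> g) x \<in> A}"

lemma sets_translates_event:
  assumes "Group.group G" "measure_preserving_maps (carrier G) M \<sigma>"
    and "finite T" "T \<subseteq> carrier G \<times> sets M"
  shows "translates_event G M \<sigma> T \<in> sets M"
proof -
  interpret Group.group G by fact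
  have "{x\<in>space M. \<sigma> (inv\<^bsub>G\<^esub> g) x \<in> A} \<in> sets M" if "(g, A) \<in> T" for g A
  proof -
    have "\<sigma> (inv\<^bsub>G\<^esub> g) \<in> measurable M M"
      using that assms by (intro measure_preserving_mapsD(1)[OF assms(2)]) auto
    then have "\<sigma> (inv\<^bsub>G\<^esub> g) -` A \<inter> space M \<in> sets M"
      using that assms(4) by (intro measurable_sets) auto
    then show ?thesis by (simp add: vimage_def Int_def conj_commute)
  qed
  then show ?thesis
    unfolding translates_event_def using assms(3)
    by (intro sets.sets_Collect_finite_All) auto
qed

text \<open>A projection is almost everywhere the indicator of the set where it equals 1, and measure
  preserving maps pull null sets back to null sets. So a product of translates of projections
  is the indicator of an intersection of translates.\<close>

lemma integral_prod_koopman_projections: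
  assumes "prob_space M" "Group.group G" and mp: "measure_preserving_maps (carrier G) M \<sigma>"
    and J: "finite J" and g: "\<And>i. i \<in> J \<Longrightarrow> g i \<in> carrier G"
    and u: "\<And>i. i \<in> J \<Longrightarrow> u i \<in> projections M"
  shows "(LINT x|M. (\<Prod>i\<in>J. koopman G \<sigma> (g i) (u i) x)) =
    of_real (measure M (translates_event G M \<sigma> ((\<lambda>i. (g i, {x\<in>space M. u i x = 1})) ` J)))"
    (is "_ = of_real (measure M ?E)")
proof -
  interpret prob_space M by fact
  interpret G: Group.group G by fact
  have meas_u: "u i \<in> borel_measurable M" if "i \<in> J" for i
    using u[OF that] by (auto simp: projections_def Linfty_def)
  have meas_\<sigma>: "\<sigma> (inv\<^bsub>G\<^esub> (g i)) \<in> measurable M M" if "i \<in> J" for i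
    using g[OF that] by (intro measure_preserving_mapsD(1)[OF mp]) auto
  have "{x\<in>space M. u i x = 1} \<in> sets M" if "i \<in> J" for i
    using measurable_sets[OF meas_u[OF that], of "{1}"] by (simp add: vimage_def Int_def conj_commute)
  then have "(\<lambda>i. (g i, {x\<in>space M. u i x = 1})) ` J \<subseteq> carrier G \<times> sets M"
    using g by blast
  then have E: "?E \<in> sets M"
    using J by (intro sets_translates_event[OF assms(2) mp] finite_imageI)
  have "AE x in M. u i (\<sigma> (inv\<^bsub>G\<^esub> (g i)) x) \<in> {0, 1}" if "i \<in> J" for i
  proof (rule AE_distrD[OF meas_\<sigma>[OF that]])
    have "AE x in M. u i x * u i x = u i x"
      using u[OF that] by (auto simp: projections_def)
    then have "AE x in M. u i x \<in> {0, 1}" by eventually_elim auto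
    then show "AE x in distr M M (\<sigma> (inv\<^bsub>G\<^esub> (g i))). u i x \<in> {0, 1}"
      by (simp only: measure_preserving_mapsD(2)[OF mp G.inv_closed[OF g[OF that]]])
  qed
  then have "AE x in M. \<forall>i\<in>J. u i (\<sigma> (inv\<^bsub>G\<^esub> (g i)) x) \<in> {0, 1}"
    by (rule AE_finite_allI[OF J])
  then have ae: "AE x in M. (\<Prod>i\<in>J. koopman G \<sigma> (g i) (u i) x) = indicator ?E x"
  proof (rule AE_mp, intro AE_I2 impI)
    fix x assume x: "x \<in> space M" and 01: "\<forall>i\<in>J. u i (\<sigma> (inv\<^bsub>G\<^esub> (g i)) x) \<in> {0, 1}"
    have sp: "\<sigma> (inv\<^bsub>G\<^esub> (g i)) x \<in> space M" if "i \<in> J" for i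
      using measurable_space[OF meas_\<sigma>[OF that] x] .
    show "(\<Prod>i\<in>J. koopman G \<sigma> (g i) (u i) x) = indicator ?E x"
    proof (cases "\<forall>i\<in>J. u i (\<sigma> (inv\<^bsub>G\<^esub> (g i)) x) = 1")
      case True
      then show ?thesis using x sp by (auto simp: koopman_def translates_event_def)
    next
      case False
      then have "x \<notin> ?E" by (auto simp: translates_event_def)
      moreover have "(\<Prod>i\<in>J. koopman G \<sigma> (g i) (u i) x) = 0"
        using False 01 J by (auto simp: koopman_def intro!: prod_zero)
      ultimately show ?thesis by simp
    qed
  qed
  have "(\<lambda>x. \<Prod>i\<in>J. koopman G \<sigma> (g i) (u i) x) \<in> borel_measurable M"
    unfolding koopman_def by (intro borel_measurable_prod measurable_compose[OF meas_\<sigma> meas_u])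
  moreover have "(indicator ?E :: 'a \<Rightarrow> complex) \<in> borel_measurable M"
    using E by (rule borel_measurable_indicator)
  ultimately have "(LINT x|M. (\<Prod>i\<in>J. koopman G \<sigma> (g i) (u i) x)) = (LINT x|M. indicator ?E x)"
    using ae by (rule integral_cong_AE)
  also have "\<dots> = (LINT x|M. complex_of_real (indicator ?E x))"
    by (intro Bochner_Integration.integral_cong refl) (simp add: indicator_def)
  also have "\<dots> = of_real (measure M ?E)"
    using sets.sets_into_space[OF E] by (simp add: Int_absorb2)
  finally show ?thesis .
qed

lemma indicator_projection:
  assumes "A \<in> sets M"
  shows "(indicator A :: 'a \<Rightarrow> complex) \<in> projections M"
proof -
  have "AE x in M. cmod (indicator A x) \<le> 1"
    by (intro AE_I2) (simp add: indicator_def)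
  then have "(indicator A :: 'a \<Rightarrow> complex) \<in> Linfty M"
    using borel_measurable_indicator[OF assms] unfolding Linfty_def by blast
  moreover have "AE x in M. (indicator A x :: complex) * indicator A x = indicator A x \<and>
      cnj (indicator A x) = indicator A x"
    by (intro AE_I2) (simp add: indicator_def)
  ultimately show ?thesis
    unfolding projections_def by blast
qed

lemma indicator_eq_1_set:
  assumes "A \<in> sets M"
  shows "{x\<in>space M. (indicator A x :: complex) = 1} = A"
  using sets.sets_into_space[OF assms] by (auto simp: indicator_def)

text \<open>The moments in the definition of weak embeddability are measures of intersections of
  translated sets. An intersection depends only on the finite set \<open>T\<close> of factors, and words of
  length at most \<open>card (F \<times> \<A>)\<close> reach every nonempty \<open>T \<subseteq> F \<times> \<A>\<close>, so sets of factors can take the place of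
  words. Letting the sets in \<open>\<A>\<close> be their own indices turns the choice of projections into a map \<open>\<Phi>\<close>.\<close>

lemma weakly_embeddable_sets_iff:
  fixes M :: "'a measure" and N :: "'b measure"
  assumes M: "prob_space M" and N: "prob_space N" and G: "Group.group G" and \<Lambda>: "Group.group \<Lambda>"
    and \<sigma>: "measure_preserving_maps (carrier G) M \<sigma>"
    and \<rho>: "measure_preserving_maps (carrier \<Lambda>) N \<rho>"
  shows "weakly_embeddable G M \<sigma> \<Lambda> N \<rho> \<delta> \<longleftrightarrow>
    \<delta> \<in> iso G \<Lambda> \<and>
    (\<forall>F \<A> \<epsilon>. finite F \<and> F \<subseteq> carrier G \<and> finite \<A> \<and> \<A> \<subseteq> sets M \<and> 0 < (\<epsilon>::real) \<longrightarrow>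
      (\<exists>\<Phi>. \<Phi> ` \<A> \<subseteq> sets N \<and> (\<forall>T \<subseteq> F \<times> \<A>.
        \<bar>measure M (translates_event G M \<sigma> T) -
         measure N (translates_event \<Lambda> N \<rho> (map_prod \<delta> \<Phi> ` T))\<bar> < \<epsilon>)))"
    (is "?W \<longleftrightarrow> ?iso \<and> ?S")
proof (intro iffI conjI)
  assume W: ?W
  show \<delta>: ?iso using W by (simp add: weakly_embeddable_def)
  show ?S
  proof (intro allI impI, elim conjE)
    fix F and \<A> :: "'a set set" and \<epsilon> :: real
    assume F: "finite F" "F \<subseteq> carrier G" and \<A>: "finite \<A>" "\<A> \<subseteq> sets M" and \<epsilon>: "0 < \<epsilon>"
    obtain a where a: "bij_betw a {1..card \<A>} \<A>"
      using ex_bij_betw_nat_finite_1[OF \<A>(1)] by blast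
    define n where "n = card \<A>"
    define ia where "ia = inv_into {1..n} a"
    have ia: "ia A \<in> {1..n}" "a (ia A) = A" if "A \<in> \<A>" for A
      using a that unfolding ia_def n_def
      by (auto simp: bij_betw_def inv_into_into f_inv_into_f simp del: atLeastAtMost_iff)
    define p where "p = (\<lambda>j. indicator (a j) :: 'a \<Rightarrow> complex)"
    have aM: "a j \<in> sets M" if "j \<in> {1..n}" for j
      using a that \<A>(2) by (auto simp: bij_betw_def n_def)
    have p: "\<forall>j\<in>{1..n}. p j \<in> projections M"
      using aM by (auto simp: p_def intro: indicator_projection)
    \<comment> \<open>Long enough for a word that lists all of \<open>F \<times> \<A>\<close>; the maximum covers empty \<open>F\<close> or \<open>\<A>\<close>.\<close>
    define K where "K = max 1 (card (F \<times> \<A>))"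
    have "finite F \<and> F \<subseteq> carrier G \<and> (\<forall>j\<in>{1..n}. p j \<in> projections M) \<and> K \<ge> 1 \<and> \<epsilon> > 0"
      using F p \<epsilon> by (simp add: K_def)
    from W[unfolded weakly_embeddable_def, THEN conjunct2, THEN spec, THEN spec, THEN spec,
        THEN spec, THEN spec, THEN mp, OF this]
    obtain q where q: "\<forall>j\<in>{1..n}. q j \<in> projections N"
      and close: "\<forall>k\<in>{1..K}. \<forall>g m. (\<forall>i\<in>{1..k}. g i \<in> F \<and> m i \<in> {1..n}) \<longrightarrow>
             cmod ((LINT x|M. (\<Prod>i=1..k. koopman G \<sigma> (g i) (p (m i)) x)) -
                   (LINT y|N. (\<Prod>i=1..k. koopman \<Lambda> \<rho> (\<delta> (g i)) (q (m i)) y))) < \<epsilon>"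
      by (elim exE conjE) (rule that)
    define \<Phi> where "\<Phi> A = {y\<in>space N. q (ia A) y = 1}" for A
    have "\<Phi> A \<in> sets N" if "A \<in> \<A>" for A
    proof -
      have "q (ia A) \<in> borel_measurable N"
        using q ia[OF that] by (auto simp: projections_def Linfty_def)
      then show ?thesis by (auto simp: \<Phi>_def)
    qed
    moreover have "\<bar>measure M (translates_event G M \<sigma> T) -
        measure N (translates_event \<Lambda> N \<rho> (map_prod \<delta> \<Phi> ` T))\<bar> < \<epsilon>" if T: "T \<subseteq> F \<times> \<A>" for T
    proof (cases "T = {}")
      case True
      then show ?thesis
        using \<epsilon> prob_space.prob_space[OF M] prob_space.prob_space[OF N]
        by (simp add: translates_event_def)
    next
      case False
      have finT: "finite T" using T F \<A> by (meson finite_SigmaI finite_subset)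
      define k where "k = card T"
      have "k \<le> card (F \<times> \<A>)" unfolding k_def using T F \<A> by (intro card_mono) auto
      then have k: "k \<in> {1..K}"
        using False finT by (auto simp: K_def k_def Suc_le_eq card_gt_0_iff)
      obtain b where b: "bij_betw b {1..k} T"
        using ex_bij_betw_nat_finite_1[OF finT] by (auto simp: k_def)
      define g where "g i = fst (b i)" for i
      define m where "m i = ia (snd (b i))" for i
      have bT: "b i \<in> T" if "i \<in> {1..k}" for i
        using b that by (auto simp: bij_betw_def)
      have gm: "g i \<in> F" "m i \<in> {1..n}" "a (m i) = snd (b i)" if "i \<in> {1..k}" for i
        using bT[OF that] T ia[of "snd (b i)"] by (auto simp: g_def m_def)
      have \<delta>G: "\<delta> g \<in> carrier \<Lambda>" if "g \<in> carrier G" for g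
        using that \<delta> by (auto simp: iso_def hom_def)
      have "(\<lambda>i. (g i, {x\<in>space M. p (m i) x = 1})) ` {1..k} = b ` {1..k}"
      proof (intro image_cong refl)
        fix i assume i: "i \<in> {1..k}"
        show "(g i, {x\<in>space M. p (m i) x = 1}) = b i"
          using gm[OF i] aM[OF gm(2)[OF i]] by (simp add: p_def indicator_eq_1_set g_def)
      qed
      also have "b ` {1..k} = T" using b by (simp add: bij_betw_def)
      finally have TM: "(\<lambda>i. (g i, {x\<in>space M. p (m i) x = 1})) ` {1..k} = T" .
      have "(\<lambda>i. (\<delta> (g i), {y\<in>space N. q (m i) y = 1})) ` {1..k} = map_prod \<delta> \<Phi> ` b ` {1..k}"
        unfolding image_image
        by (intro image_cong refl) (simp add: g_def m_def \<Phi>_def map_prod_def split_beta)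
      also have "b ` {1..k} = T" using b by (simp add: bij_betw_def)
      finally have TN: "(\<lambda>i. (\<delta> (g i), {y\<in>space N. q (m i) y = 1})) ` {1..k} = map_prod \<delta> \<Phi> ` T" .
      have gG: "g i \<in> carrier G" and pP: "p (m i) \<in> projections M" and qP: "q (m i) \<in> projections N"
        if "i \<in> {1..k}" for i
        using gm that p q F by blast+
      have "(LINT x|M. (\<Prod>i=1..k. koopman G \<sigma> (g i) (p (m i)) x)) =
          of_real (measure M (translates_event G M \<sigma> T))"
        using integral_prod_koopman_projections[OF M G \<sigma>, of "{1..k}" g "\<lambda>i. p (m i)",
            OF finite_atLeastAtMost gG pP] unfolding TM .
      moreover have "(LINT y|N. (\<Prod>i=1..k. koopman \<Lambda> \<rho> (\<delta> (g i)) (q (m i)) y)) =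
          of_real (measure N (translates_event \<Lambda> N \<rho> (map_prod \<delta> \<Phi> ` T)))"
        using integral_prod_koopman_projections[OF N \<Lambda> \<rho>, of "{1..k}" "\<lambda>i. \<delta> (g i)" "\<lambda>i. q (m i)",
            OF finite_atLeastAtMost \<delta>G[OF gG] qP] unfolding TN .
      moreover have "cmod ((LINT x|M. (\<Prod>i=1..k. koopman G \<sigma> (g i) (p (m i)) x)) -
                   (LINT y|N. (\<Prod>i=1..k. koopman \<Lambda> \<rho> (\<delta> (g i)) (q (m i)) y))) < \<epsilon>"
        using close k gm by blast
      ultimately show ?thesis
        by (simp only: of_real_diff[symmetric] norm_of_real)
    qed
    ultimately show "\<exists>\<Phi>. \<Phi> ` \<A> \<subseteq> sets N \<and> (\<forall>T \<subseteq> F \<times> \<A>.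
        \<bar>measure M (translates_event G M \<sigma> T) -
         measure N (translates_event \<Lambda> N \<rho> (map_prod \<delta> \<Phi> ` T))\<bar> < \<epsilon>)"
      by (intro exI[of _ \<Phi>]) auto
  qed
next
  assume *: "?iso \<and> ?S"
  then have \<delta>: ?iso and S: ?S by blast+
  have \<delta>G: "\<delta> g \<in> carrier \<Lambda>" if "g \<in> carrier G" for g
    using that \<delta> by (auto simp: iso_def hom_def)
  show ?W
    unfolding weakly_embeddable_def
  proof (intro conjI \<delta> allI impI, elim conjE)
    fix F and n :: nat and p :: "nat \<Rightarrow> 'a \<Rightarrow> complex" and K :: nat and \<epsilon> :: real
    assume F: "finite F" "F \<subseteq> carrier G" and p: "\<forall>j\<in>{1..n}. p j \<in> projections M" and \<epsilon>: "0 < \<epsilon>"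
    define a where "a j = {x\<in>space M. p j x = 1}" for j
    have "a j \<in> sets M" if "j \<in> {1..n}" for j
    proof -
      have "p j \<in> borel_measurable M"
        using p that by (auto simp: projections_def Linfty_def)
      then show ?thesis by (auto simp: a_def)
    qed
    then have "finite F \<and> F \<subseteq> carrier G \<and> finite (a ` {1..n}) \<and> a ` {1..n} \<subseteq> sets M \<and> 0 < \<epsilon>"
      using F \<epsilon> by auto
    from S[THEN spec, THEN spec, THEN spec, THEN mp, OF this] obtain \<Phi> where \<Phi>: "\<Phi> ` a ` {1..n} \<subseteq> sets N"
      and close: "\<And>T. T \<subseteq> F \<times> a ` {1..n} \<Longrightarrow>
        \<bar>measure M (translates_event G M \<sigma> T) -
         measure N (translates_event \<Lambda> N \<rho> (map_prod \<delta> \<Phi> ` T))\<bar> < \<epsilon>"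
      by (elim exE conjE) (rule that, auto)
    define q where "q j = (indicator (\<Phi> (a j)) :: 'b \<Rightarrow> complex)" for j
    have q: "\<forall>j\<in>{1..n}. q j \<in> projections N"
      using \<Phi> by (auto simp: q_def intro!: indicator_projection)
    have "cmod ((LINT x|M. (\<Prod>i=1..k. koopman G \<sigma> (g i) (p (m i)) x)) -
                   (LINT y|N. (\<Prod>i=1..k. koopman \<Lambda> \<rho> (\<delta> (g i)) (q (m i)) y))) < \<epsilon>"
      if gm: "\<forall>i\<in>{1..k}. g i \<in> F \<and> m i \<in> {1..n}" for k :: nat and g m
    proof -
      define T where "T = (\<lambda>i. (g i, a (m i))) ` {1..k}"
      have T: "T \<subseteq> F \<times> a ` {1..n}" using gm by (auto simp: T_def)
      have TN: "(\<lambda>i. (\<delta> (g i), {y\<in>space N. q (m i) y = 1})) ` {1..k} = map_prod \<delta> \<Phi> ` T"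
        unfolding T_def image_image
      proof (intro image_cong refl)
        fix i assume "i \<in> {1..k}"
        then have "\<Phi> (a (m i)) \<in> sets N" using gm \<Phi> by auto
        then show "(\<delta> (g i), {y\<in>space N. q (m i) y = 1}) = map_prod \<delta> \<Phi> (g i, a (m i))"
          by (simp add: q_def indicator_eq_1_set)
      qed
      have gG: "g i \<in> carrier G" and pP: "p (m i) \<in> projections M" and qP: "q (m i) \<in> projections N"
        if "i \<in> {1..k}" for i
        using gm that p q F by blast+
      have "(LINT x|M. (\<Prod>i=1..k. koopman G \<sigma> (g i) (p (m i)) x)) =
          of_real (measure M (translates_event G M \<sigma> T))"
        using integral_prod_koopman_projections[OF M G \<sigma>, of "{1..k}" g "\<lambda>i. p (m i)",
            OF finite_atLeastAtMost gG pP] unfolding T_def a_def .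
      moreover have "(LINT y|N. (\<Prod>i=1..k. koopman \<Lambda> \<rho> (\<delta> (g i)) (q (m i)) y)) =
          of_real (measure N (translates_event \<Lambda> N \<rho> (map_prod \<delta> \<Phi> ` T)))"
        using integral_prod_koopman_projections[OF N \<Lambda> \<rho>, of "{1..k}" "\<lambda>i. \<delta> (g i)" "\<lambda>i. q (m i)",
            OF finite_atLeastAtMost \<delta>G[OF gG] qP] unfolding TN .
      ultimately show ?thesis
        using close[OF T] by (simp only: of_real_diff[symmetric] norm_of_real)
    qed
    with q show "\<exists>q. (\<forall>j\<in>{1..n}. q j \<in> projections N) \<and>
          (\<forall>k\<in>{1..K}. \<forall>g m. (\<forall>i\<in>{1..k}. g i \<in> F \<and> m i \<in> {1..n}) \<longrightarrow>
             cmod ((LINT x|M. (\<Prod>i=1..k. koopman G \<sigma> (g i) (p (m i)) x)) -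
                   (LINT y|N. (\<Prod>i=1..k. koopman \<Lambda> \<rho> (\<delta> (g i)) (q (m i)) y))) < \<epsilon>)"
      by blast
  qed
qed

section \<open>The co-induced action as an action on equivariant families\<close>

locale coinduction_data = group G + subgroup H G
  for G (structure) and H +
  fixes S :: "'a set" and M :: "'x measure" and \<sigma> :: "'a \<Rightarrow> 'x \<Rightarrow> 'x"
  assumes reps: "coset_reps G H S"
    and prob_space_base: "prob_space M"
    and pmp_base: "pmp_action (G\<lparr>carrier := H\<rparr>) M \<sigma>"
begin

abbreviation "\<pi> \<equiv> coset_pi G H S"
abbreviation "coindM \<equiv> coind_space G H M"
abbreviation "coind\<sigma> \<equiv> coind_action G H S \<sigma>"

text \<open>The Koopman formula for the co-induction hides an equivariant description. A point \<open>t\<close> of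
  \<open>X\<close> to the power \<open>G/H\<close> extends to a function \<open>\<gamma> \<mapsto> ev \<gamma> t\<close> on the whole group \<open>G\<close> that satisfies
  \<open>ev (\<gamma>h) t = \<sigma> (h\<inverse>) (ev \<gamma> t)\<close> and has the coordinates of \<open>t\<close> as its values on the representatives \<open>S\<close>.
  In these terms the cocycle disappears: the co-induced action is left translation of functions
  on \<open>G\<close> (lemma \<open>ev_coind_action\<close>). Since \<open>ev\<close> is indexed by group elements, isomorphisms of \<open>G\<close> act
  on the index directly, whether or not they respect the chosen representatives.\<close>

definition ev :: "'a \<Rightarrow> ('a set \<Rightarrow> 'x) \<Rightarrow> 'x" where
  "ev \<gamma> t = \<sigma> (inv (\<pi> \<gamma>)) (t (\<gamma> <# H))"

lemma is_subgroup: "subgroup H G" ..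

lemma reps_carrier: "s \<in> S \<Longrightarrow> s \<in> carrier G"
  using reps by (auto simp: coset_reps_def)

lemma base_measurable: "h \<in> H \<Longrightarrow> \<sigma> h \<in> measurable M M"
  and base_distr: "h \<in> H \<Longrightarrow> distr M M (\<sigma> h) = M"
  and base_one: "x \<in> space M \<Longrightarrow> \<sigma> \<one> x = x"
  and base_mult: "h \<in> H \<Longrightarrow> k \<in> H \<Longrightarrow> x \<in> space M \<Longrightarrow> \<sigma> (h \<otimes> k) x = \<sigma> h (\<sigma> k x)"
  using pmp_base by (auto simp: pmp_action_def)

lemma left_coset_eq_iff:
  assumes "\<gamma> \<in> carrier G" "\<gamma>' \<in> carrier G"
  shows "\<gamma> <# H = \<gamma>' <# H \<longleftrightarrow> (\<exists>h\<in>H. \<gamma>' = \<gamma> \<otimes> h)"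
proof
  assume "\<gamma> <# H = \<gamma>' <# H"
  then have "\<gamma>' \<in> \<gamma> <# H"
    using lcos_self[OF assms(2) is_subgroup] by simp
  then show "\<exists>h\<in>H. \<gamma>' = \<gamma> \<otimes> h" by (auto simp: l_coset_def)
next
  assume "\<exists>h\<in>H. \<gamma>' = \<gamma> \<otimes> h"
  then have "\<gamma>' \<in> \<gamma> <# H" by (auto simp: l_coset_def)
  then show "\<gamma> <# H = \<gamma>' <# H"
    using l_repr_independence[of \<gamma>' \<gamma> H] assms is_subgroup by simp
qed

lemma lcoset_in_lcosets: "\<gamma> \<in> carrier G \<Longrightarrow> \<gamma> <# H \<in> lcosets H"
  by (auto simp: LCOSETS_def)

lemma lcosets_rep: "C \<in> lcosets H \<Longrightarrow> \<exists>s\<in>S. C = s <# H"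
proof -
  assume C: "C \<in> lcosets H"
  then obtain \<gamma> where \<gamma>: "\<gamma> \<in> carrier G" "C = \<gamma> <# H" by (auto simp: LCOSETS_def)
  obtain s where s: "s \<in> S" "s \<in> C" using reps C by (auto simp: coset_reps_def)
  then have "\<gamma> <# H = s <# H"
    using left_coset_eq_iff[OF \<gamma>(1) reps_carrier[OF s(1)]] \<gamma> by (auto simp: l_coset_def)
  then show ?thesis using s \<gamma> by auto
qed

lemma coset_pi_rep_mult: "s \<in> S \<Longrightarrow> h \<in> H \<Longrightarrow> \<pi> (s \<otimes> h) = h"
  using coset_rep_eq(2)[OF is_group is_subgroup reps] .

lemma coset_pi_rep: "s \<in> S \<Longrightarrow> \<pi> s = \<one>"
  using coset_pi_rep_mult[of s \<one>] reps_carrier by simp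

lemma rep_decomposition:
  assumes "\<gamma> \<in> carrier G"
  obtains s h where "s \<in> S" "h \<in> H" "\<gamma> = s \<otimes> h"
proof -
  obtain s where s: "s \<in> S" "\<gamma> <# H = s <# H"
    using lcosets_rep[OF lcoset_in_lcosets[OF assms]] by auto
  then show thesis
    using left_coset_eq_iff[OF reps_carrier[OF s(1)] assms] that by auto
qed

lemma coset_pi_in: "\<gamma> \<in> carrier G \<Longrightarrow> \<pi> \<gamma> \<in> H"
  by (metis rep_decomposition coset_pi_rep_mult)

lemma rep_mult_inv_coset_pi:
  assumes "\<gamma> \<in> carrier G"
  shows "\<gamma> \<otimes> inv (\<pi> \<gamma>) \<in> S"
proof -
  obtain s h where "s \<in> S" "h \<in> H" "\<gamma> = s \<otimes> h"
    using rep_decomposition[OF assms] .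
  then show ?thesis
    by (simp add: coset_pi_rep_mult m_assoc reps_carrier)
qed

lemma coset_pi_mult:
  assumes "\<gamma> \<in> carrier G" "h \<in> H"
  shows "\<pi> (\<gamma> \<otimes> h) = \<pi> \<gamma> \<otimes> h"
proof -
  obtain s k where s: "s \<in> S" "k \<in> H" "\<gamma> = s \<otimes> k"
    using rep_decomposition[OF assms(1)] .
  then have "\<gamma> \<otimes> h = s \<otimes> (k \<otimes> h)"
    using reps_carrier assms by (simp add: m_assoc)
  then show ?thesis
    using s assms by (simp add: coset_pi_rep_mult)
qed

lemma coset_cocycle_rep:
  assumes "s \<in> S" "g \<in> carrier G"
  shows "coset_cocycle G H S g (s <# H) = \<pi> (g \<otimes> s)"
  using assms coset_rep_eq(1)[OF is_group is_subgroup reps assms(1) one_closed]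
    coset_pi_in[of "g \<otimes> s"] reps_carrier
  by (simp add: coset_cocycle_def coset_pi_rep)

lemma space_coindD: "t \<in> space coindM \<Longrightarrow> C \<in> lcosets H \<Longrightarrow> t C \<in> space M"
  by (auto simp: coind_space_def space_PiM)

lemma ev_measurable:
  assumes "\<gamma> \<in> carrier G"
  shows "ev \<gamma> \<in> measurable coindM M"
proof -
  have "(\<lambda>t. t (\<gamma> <# H)) \<in> measurable coindM M"
    unfolding coind_space_def by (rule measurable_component_singleton[OF lcoset_in_lcosets[OF assms]])
  then show ?thesis
    unfolding ev_def[abs_def]
    by (rule measurable_compose[OF _ base_measurable]) (use coset_pi_in[OF assms] in simp)
qed

lemma ev_rep:
  assumes "s \<in> S" "t \<in> space coindM"
  shows "ev s t = t (s <# H)"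
  using assms space_coindD[OF assms(2) lcoset_in_lcosets[OF reps_carrier[OF assms(1)]]]
  by (simp add: ev_def coset_pi_rep base_one)

lemma ev_mult:
  assumes "\<gamma> \<in> carrier G" "h \<in> H" "t \<in> space coindM"
  shows "ev (\<gamma> \<otimes> h) t = \<sigma> (inv h) (ev \<gamma> t)"
proof -
  have "(\<gamma> \<otimes> h) <# H = \<gamma> <# H"
    using left_coset_eq_iff[of \<gamma> "\<gamma> \<otimes> h"] assms by auto
  moreover have "inv (\<pi> \<gamma> \<otimes> h) = inv h \<otimes> inv (\<pi> \<gamma>)"
    using coset_pi_in[OF assms(1)] assms by (simp add: inv_mult_group)
  ultimately show ?thesis
    using assms coset_pi_in[OF assms(1)] space_coindD[OF assms(3) lcoset_in_lcosets[OF assms(1)]]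
    by (simp add: ev_def coset_pi_mult base_mult)
qed

text \<open>The cocycle is the correction needed to write \<open>g\<inverse>s\<close> as a representative \<open>s'\<close> times an element \<open>h\<close>
  of \<open>H\<close>: it takes the value \<open>h\<inverse>\<close>, which is also what \<open>H\<close>-equivariance produces from \<open>ev (s'h)\<close>.\<close>

lemma coind_action_apply:
  assumes s: "s \<in> S" and g: "g \<in> carrier G" and t: "t \<in> space coindM"
  shows "coind\<sigma> g t (s <# H) = ev (inv g \<otimes> s) t"
proof -
  have sG: "s \<in> carrier G" by (rule reps_carrier[OF s])
  obtain s' h where s': "s' \<in> S" "h \<in> H" "inv g \<otimes> s = s' \<otimes> h"
    using rep_decomposition[of "inv g \<otimes> s"] sG g by auto
  have s'G: "s' \<in> carrier G" by (rule reps_carrier[OF s'(1)])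
  have C: "inv g <# (s <# H) = s' <# H"
    using lcos_m_assoc[of H "inv g" s] left_coset_eq_iff[of s' "s' \<otimes> h"] s' s'G sG g subset by auto
  have "g \<otimes> (s' \<otimes> h) = s"
    unfolding s'(3)[symmetric] using g sG by (simp add: m_assoc[symmetric])
  then have "g \<otimes> s' = s \<otimes> inv h"
    using s'(2) s'G g by (auto simp: m_assoc)
  then have "coset_cocycle G H S g (s' <# H) = inv h"
    using s s' g by (simp add: coset_cocycle_rep coset_pi_rep_mult)
  then have "coind\<sigma> g t (s <# H) = \<sigma> (inv h) (ev s' t)"
    using C lcoset_in_lcosets[OF sG] s'(1) t by (simp add: coind_action_def ev_rep)
  then show ?thesis
    using s' s'G t by (simp add: ev_mult)
qed

lemma coind_action_measurable:
  assumes g: "g \<in> carrier G"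
  shows "coind\<sigma> g \<in> measurable coindM coindM"
proof -
  have "coind\<sigma> g \<in> measurable coindM (PiM (lcosets H) (\<lambda>_. M)) \<longleftrightarrow>
      (\<lambda>t. \<lambda>C\<in>lcosets H. coind\<sigma> g t C) \<in> measurable coindM (PiM (lcosets H) (\<lambda>_. M))"
    by (intro measurable_cong) (auto simp: coind_action_def fun_eq_iff restrict_def)
  moreover have "(\<lambda>t. coind\<sigma> g t C) \<in> measurable coindM M" if C: "C \<in> lcosets H" for C
  proof -
    obtain s where s: "s \<in> S" "C = s <# H" using lcosets_rep[OF C] by auto
    have "(\<lambda>t. coind\<sigma> g t C) \<in> measurable coindM M \<longleftrightarrow> ev (inv g \<otimes> s) \<in> measurable coindM M"
      using s g by (intro measurable_cong) (simp add: coind_action_apply)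
    then show ?thesis
      using ev_measurable[of "inv g \<otimes> s"] s g reps_carrier by simp
  qed
  ultimately show ?thesis
    by (simp add: coind_space_def)
qed

lemma coind_action_space:
  "g \<in> carrier G \<Longrightarrow> t \<in> space coindM \<Longrightarrow> coind\<sigma> g t \<in> space coindM"
  using measurable_space[OF coind_action_measurable] .

lemma ev_coind_action:
  assumes \<gamma>: "\<gamma> \<in> carrier G" and g: "g \<in> carrier G" and t: "t \<in> space coindM"
  shows "ev \<gamma> (coind\<sigma> g t) = ev (inv g \<otimes> \<gamma>) t"
proof -
  obtain s h where s: "s \<in> S" "h \<in> H" "\<gamma> = s \<otimes> h"
    using rep_decomposition[OF \<gamma>] .
  have sG: "s \<in> carrier G" by (rule reps_carrier[OF s(1)])
  have "inv g \<otimes> \<gamma> = (inv g \<otimes> s) \<otimes> h"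
    using s sG g by (simp add: m_assoc)
  then show ?thesis
    using s sG g t by (simp add: ev_mult coind_action_space ev_rep coind_action_apply)
qed

lemma coind_action_pattern_event:
  assumes g: "g \<in> carrier G" and t: "t \<in> space coindM"
    and r: "\<And>i. i \<in> E \<Longrightarrow> r i \<in> carrier G"
  shows "coind\<sigma> (inv g) t \<in> pattern_event coindM (\<lambda>i. {t\<in>space coindM. ev (r i) t \<in> D i}) E P
    \<longleftrightarrow> P {i\<in>E. ev (g \<otimes> r i) t \<in> D i}"
proof -
  have t': "coind\<sigma> (inv g) t \<in> space coindM" using g t by (simp add: coind_action_space)
  have "{i\<in>E. ev (r i) (coind\<sigma> (inv g) t) \<in> D i} = {i\<in>E. ev (g \<otimes> r i) t \<in> D i}"
    using g t r by (auto simp: ev_coind_action)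
  then show ?thesis
    using t' by (simp add: pattern_event_def)
qed

lemma prob_space_coind: "prob_space coindM"
  unfolding coind_space_def by (intro prob_space_PiM prob_space_base)

text \<open>The evaluations at group elements in distinct cosets are independent and distributed
  according to \<open>M\<close>: they are different coordinates of a product measure, each followed by a measure
  preserving map.\<close>

lemma measure_ev_joint:
  assumes J: "finite J" and r: "\<And>j. j \<in> J \<Longrightarrow> r j \<in> carrier G"
    and inj: "inj_on (\<lambda>j. r j <# H) J" and D: "\<And>j. j \<in> J \<Longrightarrow> D j \<in> sets M"
  shows "measure coindM {t\<in>space coindM. \<forall>j\<in>J. ev (r j) t \<in> D j} = (\<Prod>j\<in>J. measure M (D j))"
proof -
  interpret prob_space M by (rule prob_space_base)
  interpret P: product_prob_space "\<lambda>_::'a set. M" "lcosets H" ..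
  define k where "k j = inv (\<pi> (r j))" for j
  define C where "C j = r j <# H" for j
  define jj where "jj = inv_into J C"
  define B where "B j = \<sigma> (k j) -` D j \<inter> space M" for j
  have injC: "inj_on C J" using inj by (simp add: C_def[abs_def])
  have jj: "jj (C j) = j" if "j \<in> J" for j
    using inv_into_f_f[OF injC that] by (simp add: jj_def)
  have k: "k j \<in> H" if "j \<in> J" for j using coset_pi_in[OF r[OF that]] by (simp add: k_def)
  have B: "B j \<in> sets M" "measure M (B j) = measure M (D j)" if "j \<in> J" for j
  proof -
    show "B j \<in> sets M"
      unfolding B_def by (rule measurable_sets[OF base_measurable[OF k[OF that]] D[OF that]])
    have "measure M (B j) = measure (distr M M (\<sigma> (k j))) (D j)"
      unfolding B_def by (rule measure_distr[OF base_measurable[OF k[OF that]] D[OF that], symmetric])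
    then show "measure M (B j) = measure M (D j)" using base_distr[OF k[OF that]] by simp
  qed
  have CJ: "C ` J \<subseteq> lcosets H" using r by (auto simp: C_def intro: lcoset_in_lcosets)
  have "{t\<in>space coindM. \<forall>j\<in>J. ev (r j) t \<in> D j} =
      prod_emb (lcosets H) (\<lambda>_. M) (C ` J) (Pi\<^sub>E (C ` J) (\<lambda>c. B (jj c)))"
    using CJ
    by (auto simp: prod_emb_def coind_space_def space_PiM PiE_iff ev_def B_def jj k_def[symmetric]
        C_def[symmetric] image_subset_iff extensional_def)
  moreover have "B (jj c) \<in> sets M" if "c \<in> C ` J" for c
    using that B jj by auto
  ultimately have "measure coindM {t\<in>space coindM. \<forall>j\<in>J. ev (r j) t \<in> D j} =
      (\<Prod>c\<in>C ` J. measure M (B (jj c)))"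
    unfolding coind_space_def
    using P.measure_PiM_emb[OF CJ finite_imageI[OF J], of "\<lambda>c. B (jj c)"] by simp
  also have "\<dots> = (\<Prod>j\<in>J. measure M (D j))"
    by (subst prod.reindex[OF injC]) (auto simp: jj B intro!: prod.cong)
  finally show ?thesis .
qed

text \<open>The coordinates of a translated point at distinct cosets are evaluations of the original point
  at distinct cosets, hence again independent with law \<open>M\<close>; this characterises the product measure.\<close>

lemma coind_action_measure_preserving:
  "measure_preserving_maps (carrier G) coindM coind\<sigma>"
  unfolding measure_preserving_maps_def
proof (intro ballI conjI)
  fix g assume g: "g \<in> carrier G"
  interpret prob_space M by (rule prob_space_base)
  interpret P: product_prob_space "\<lambda>_::'a set. M" "lcosets H" ..
  interpret Q: prob_space coindM by (rule prob_space_coind)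
  show meas: "coind\<sigma> g \<in> measurable coindM coindM" by (rule coind_action_measurable[OF g])
  interpret D: prob_space "distr coindM coindM (coind\<sigma> g)" by (rule Q.prob_space_distr[OF meas])
  show "distr coindM coindM (coind\<sigma> g) = coindM"
  proof (subst (3) coind_space_def, rule P.PiM_eq)
    show "sets (distr coindM coindM (coind\<sigma> g)) = sets (PiM (lcosets H) (\<lambda>_. M))"
      by (simp add: coind_space_def)
    fix J and F :: "'a set \<Rightarrow> 'x set"
    assume J: "finite J" "J \<subseteq> lcosets H" and F: "\<And>j. j \<in> J \<Longrightarrow> F j \<in> sets M"
    define s where "s C = (SOME s. s \<in> S \<and> C = s <# H)" for C
    have s: "s C \<in> S" "C = s C <# H" if "C \<in> J" for C
      using someI_ex[of "\<lambda>s. s \<in> S \<and> C = s <# H"] lcosets_rep[of C] that J by (auto simp: s_def)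
    have sG: "s C \<in> carrier G" if "C \<in> J" for C using s[OF that] reps_carrier by auto
    have inj: "inj_on (\<lambda>C. (inv g \<otimes> s C) <# H) J"
    proof (rule inj_on_inverseI)
      fix C assume "C \<in> J"
      then show "g <# ((inv g \<otimes> s C) <# H) = C"
        using lcos_m_assoc[of H g "inv g \<otimes> s C"] g sG s(2) subset by (simp add: m_assoc[symmetric])
    qed
    let ?E = "prod_emb (lcosets H) (\<lambda>_. M) J (Pi\<^sub>E J F)"
    have E: "?E \<in> sets coindM"
      unfolding coind_space_def using J F by (intro sets_PiM_I) auto
    have "coind\<sigma> g -` ?E \<inter> space coindM = {t\<in>space coindM. \<forall>C\<in>J. ev (inv g \<otimes> s C) t \<in> F C}"
    proof (intro equalityI subsetI)
      fix t assume t: "t \<in> coind\<sigma> g -` ?E \<inter> space coindM"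
      then have "coind\<sigma> g t C \<in> F C" if "C \<in> J" for C
        using that by (auto simp: prod_emb_def PiE_iff)
      then show "t \<in> {t\<in>space coindM. \<forall>C\<in>J. ev (inv g \<otimes> s C) t \<in> F C}"
        using t coind_action_apply[OF s(1) g, of _ t] s(2) by auto
    next
      fix t assume t: "t \<in> {t\<in>space coindM. \<forall>C\<in>J. ev (inv g \<otimes> s C) t \<in> F C}"
      then have "coind\<sigma> g t C \<in> F C" if "C \<in> J" for C
        using coind_action_apply[OF s(1) g, of C t] s(2)[OF that] that by auto
      moreover have "coind\<sigma> g t \<in> space coindM" using t g by (auto intro: coind_action_space)
      ultimately show "t \<in> coind\<sigma> g -` ?E \<inter> space coindM"
        using t by (auto simp: prod_emb_def PiE_iff coind_space_def space_PiM)
    qed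
    then have "measure (distr coindM coindM (coind\<sigma> g)) ?E =
        measure coindM {t\<in>space coindM. \<forall>C\<in>J. ev (inv g \<otimes> s C) t \<in> F C}"
      by (simp add: measure_distr[OF meas E])
    also have "\<dots> = (\<Prod>C\<in>J. measure M (F C))"
      using J F g sG inj by (intro measure_ev_joint) auto
    finally show "emeasure (distr coindM coindM (coind\<sigma> g)) ?E = (\<Prod>C\<in>J. emeasure M (F C))"
      by (simp add: D.emeasure_eq_measure emeasure_eq_measure prod_ennreal)
  qed
qed

text \<open>A moment of evaluations factors over the cosets: inside the coset of \<open>r j\<close> all evaluations are
  functions of the single variable \<open>ev (r j)\<close>, and equivariance turns the conditions on them into a
  moment of the action \<open>\<sigma>\<close> on \<open>M\<close>.\<close>

lemma measure_ev_translates: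
  assumes J: "finite J" and r: "\<And>j. j \<in> J \<Longrightarrow> r j \<in> carrier G"
    and inj: "inj_on (\<lambda>j. r j <# H) J"
    and T: "\<And>j. j \<in> J \<Longrightarrow> finite (T j)" "\<And>j. j \<in> J \<Longrightarrow> T j \<subseteq> H \<times> sets M"
  shows "measure coindM {t\<in>space coindM. \<forall>j\<in>J. \<forall>(h, A)\<in>T j. ev (r j \<otimes> h) t \<in> A} =
    (\<Prod>j\<in>J. measure M (translates_event (G\<lparr>carrier := H\<rparr>) M \<sigma> (T j)))"
proof -
  have grp: "Group.group (G\<lparr>carrier := H\<rparr>)"
    by (rule subgroup_is_group[OF is_group])
  have "{t\<in>space coindM. \<forall>j\<in>J. \<forall>(h, A)\<in>T j. ev (r j \<otimes> h) t \<in> A} =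
      {t\<in>space coindM. \<forall>j\<in>J. ev (r j) t \<in> translates_event (G\<lparr>carrier := H\<rparr>) M \<sigma> (T j)}"
  proof (intro Collect_cong conj_cong refl ball_cong)
    fix t j assume t: "t \<in> space coindM" and j: "j \<in> J"
    have "ev (r j) t \<in> space M" by (rule measurable_space[OF ev_measurable[OF r[OF j]] t])
    moreover have "ev (r j \<otimes> h) t = \<sigma> (inv\<^bsub>G\<lparr>carrier := H\<rparr>\<^esub> h) (ev (r j) t)" if "(h, A) \<in> T j" for h A
    proof -
      have "h \<in> H" using T(2)[OF j] that by auto
      then show ?thesis using r[OF j] t by (simp add: ev_mult m_inv_consistent[OF is_subgroup])
    qed
    ultimately show "(\<forall>(h, A)\<in>T j. ev (r j \<otimes> h) t \<in> A) \<longleftrightarrow>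
        ev (r j) t \<in> translates_event (G\<lparr>carrier := H\<rparr>) M \<sigma> (T j)"
      unfolding translates_event_def by fastforce
  qed
  moreover have "translates_event (G\<lparr>carrier := H\<rparr>) M \<sigma> (T j) \<in> sets M" if "j \<in> J" for j
    using T[OF that] pmp_action_measure_preserving[OF pmp_base]
    by (intro sets_translates_event[OF grp]) auto
  ultimately show ?thesis
    using measure_ev_joint[OF J r inj, of "\<lambda>j. translates_event (G\<lparr>carrier := H\<rparr>) M \<sigma> (T j)"] by simp
qed

lemma sets_coind_generated:
  "sets coindM = sigma_sets (space coindM)
     ((\<lambda>i. {t\<in>space coindM. ev (fst i) t \<in> snd i}) ` (S \<times> sets M))"
proof -
  have sp: "space coindM = (\<Pi>\<^sub>E C\<in>lcosets H. space M)"
    by (simp add: coind_space_def space_PiM)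
  have "{{f \<in> \<Pi>\<^sub>E C\<in>lcosets H. space M. f C \<in> A} | C A. C \<in> lcosets H \<and> A \<in> sets M} =
      (\<lambda>i. {t\<in>space coindM. ev (fst i) t \<in> snd i}) ` (S \<times> sets M)" (is "?L = ?R")
  proof (intro equalityI subsetI)
    fix Y assume "Y \<in> ?L"
    then obtain C A where C: "C \<in> lcosets H" "A \<in> sets M"
      "Y = {f \<in> \<Pi>\<^sub>E C\<in>lcosets H. space M. f C \<in> A}" by auto
    obtain s where "s \<in> S" "C = s <# H" using lcosets_rep[OF C(1)] by auto
    then have "(s, A) \<in> S \<times> sets M" "Y = {t\<in>space coindM. ev s t \<in> A}"
      unfolding C(3) sp[symmetric] using C(2) by (auto simp: ev_rep)
    then show "Y \<in> ?R" by (auto intro!: image_eqI[of _ _ "(s, A)"])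
  next
    fix Y assume "Y \<in> ?R"
    then obtain s A where s: "s \<in> S" "A \<in> sets M" "Y = {t\<in>space coindM. ev s t \<in> A}" by auto
    then have "Y = {t\<in>space coindM. t (s <# H) \<in> A}" by (auto simp: ev_rep)
    then show "Y \<in> ?L"
      using s lcoset_in_lcosets[OF reps_carrier[OF s(1)]] by (auto simp: coind_space_def space_PiM)
  qed
  then show ?thesis
    unfolding coind_space_def sets_PiM_single space_PiM by simp
qed

end

section \<open>Co-induction preserves weak embeddability\<close>

text \<open>Both moments factor over the cosets met by \<open>T\<close>, with corresponding factors since \<open>\<Delta>\<close> maps
  cosets of \<open>H\<close> to cosets of \<open>K\<close> and agrees with \<open>\<delta>\<close> on \<open>H\<close>. Corresponding factors are moments of the two base
  actions, so they differ by at most \<open>\<eta>\<close>; a product of numbers in \<open>[0, 1]\<close> then changes by at most the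
  sum of the changes of its factors. The representatives \<open>\<Delta> s\<close> used on the side of \<open>N\<close> need not lie in \<open>S'\<close>,
  which is harmless because the factorisation holds for any representatives.\<close>

lemma evaluation_moment_diff_le:
  assumes cM: "coinduction_data G H S M \<sigma>" and cN: "coinduction_data \<Lambda> K S' N \<rho>"
    and \<Delta>: "\<Delta> \<in> iso G \<Lambda>" and \<delta>: "\<delta> \<in> iso (G\<lparr>carrier := H\<rparr>) (\<Lambda>\<lparr>carrier := K\<rparr>)"
    and ext: "\<And>h. h \<in> H \<Longrightarrow> \<Delta> h = \<delta> h"
    and E: "finite E" "E \<subseteq> carrier G \<times> \<A>" and \<A>: "\<A> \<subseteq> sets M" and \<Phi>: "\<Phi> ` \<A> \<subseteq> sets N"
    and close: "\<And>T. T \<subseteq> (coset_pi G H S ` fst ` E) \<times> \<A> \<Longrightarrow>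
      \<bar>measure M (translates_event (G\<lparr>carrier := H\<rparr>) M \<sigma> T) -
       measure N (translates_event (\<Lambda>\<lparr>carrier := K\<rparr>) N \<rho> (map_prod \<delta> \<Phi> ` T))\<bar> \<le> \<eta>"
    and T: "T \<subseteq> E"
  shows "\<bar>measure (coind_space G H M)
        {t\<in>space (coind_space G H M). \<forall>i\<in>T. coinduction_data.ev G H S \<sigma> (fst i) t \<in> snd i} -
      measure (coind_space \<Lambda> K N)
        {t\<in>space (coind_space \<Lambda> K N). \<forall>i\<in>T. coinduction_data.ev \<Lambda> K S' \<rho> (\<Delta> (fst i)) t \<in> \<Phi> (snd i)}\<bar>
    \<le> real (card E) * \<eta>"
proof -
  interpret A: coinduction_data G H S M \<sigma> by fact
  interpret B: coinduction_data \<Lambda> K S' N \<rho> by fact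
  interpret M: prob_space M by (rule A.prob_space_base)
  interpret N: prob_space N by (rule B.prob_space_base)
  interpret \<Delta>: group_hom G \<Lambda> \<Delta>
    using \<Delta> A.is_group B.is_group by (simp add: group_hom_def group_hom_axioms_def iso_def)
  have \<Delta>_inj: "inj_on \<Delta> (carrier G)" using \<Delta> by (simp add: iso_def bij_betw_def)
  have \<delta>H: "\<delta> ` H = K" using \<delta> by (simp add: iso_def bij_betw_def)
  \<comment> \<open>\<open>J\<close> consists of the representatives of the cosets met by \<open>T\<close>, and \<open>Q s\<close> is the part of \<open>T\<close> in \<open>sH\<close>.\<close>
  define J where "J = (\<lambda>\<gamma>. \<gamma> \<otimes>\<^bsub>G\<^esub> inv\<^bsub>G\<^esub> A.\<pi> \<gamma>) ` fst ` T"
  define Q where "Q s = {(h, A). h \<in> H \<and> (s \<otimes>\<^bsub>G\<^esub> h, A) \<in> T}" for s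
  have TG: "fst ` T \<subseteq> carrier G" using T E by auto
  have finT: "finite T" using T E(1) by (rule finite_subset)
  have J: "finite J" "J \<subseteq> S"
    using finT TG A.rep_mult_inv_coset_pi by (auto simp: J_def)
  have JG: "s \<in> carrier G" if "s \<in> J" for s using J that A.reps_carrier by auto
  have cardJ: "card J \<le> card E"
  proof -
    have "card J \<le> card (fst ` T)" unfolding J_def using finT by (intro card_image_le) simp
    also have "\<dots> \<le> card T" using finT by (rule card_image_le)
    also have "\<dots> \<le> card E" using T E(1) by (intro card_mono)
    finally show ?thesis .
  qed
  have Q: "Q s \<subseteq> (A.\<pi> ` fst ` E) \<times> \<A>" if "s \<in> J" for s
  proof
    fix y assume "y \<in> Q s"
    then obtain h A where y: "y = (h, A)" "h \<in> H" "(s \<otimes>\<^bsub>G\<^esub> h, A) \<in> T" by (auto simp: Q_def)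
    then have "A.\<pi> (s \<otimes>\<^bsub>G\<^esub> h) = h" using J that by (auto simp: A.coset_pi_rep_mult)
    then show "y \<in> (A.\<pi> ` fst ` E) \<times> \<A>" using y T E by force
  qed
  have QH: "Q s \<subseteq> H \<times> sets M" if "s \<in> J" for s
    using Q[OF that] \<A> by (auto simp: Q_def)
  have Qfin: "finite (Q s)" if "s \<in> J" for s
  proof -
    have "(\<lambda>(h, A). (s \<otimes>\<^bsub>G\<^esub> h, A)) ` Q s \<subseteq> T" by (auto simp: Q_def)
    moreover have "inj_on (\<lambda>(h, A). (s \<otimes>\<^bsub>G\<^esub> h, A)) (Q s)"
      using JG[OF that] by (auto simp: inj_on_def Q_def)
    ultimately show ?thesis using finT finite_imageD finite_subset by blast
  qed
  have Tiff: "(\<forall>i\<in>T. R (fst i) (snd i)) \<longleftrightarrow> (\<forall>s\<in>J. \<forall>(h, A)\<in>Q s. R (s \<otimes>\<^bsub>G\<^esub> h) A)" for R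
  proof
    assume "\<forall>i\<in>T. R (fst i) (snd i)"
    then show "\<forall>s\<in>J. \<forall>(h, A)\<in>Q s. R (s \<otimes>\<^bsub>G\<^esub> h) A" by (force simp: Q_def)
  next
    assume *: "\<forall>s\<in>J. \<forall>(h, A)\<in>Q s. R (s \<otimes>\<^bsub>G\<^esub> h) A"
    show "\<forall>i\<in>T. R (fst i) (snd i)"
    proof
      fix i assume i: "i \<in> T"
      define s where "s = fst i \<otimes>\<^bsub>G\<^esub> inv\<^bsub>G\<^esub> A.\<pi> (fst i)"
      have fi: "fst i \<in> carrier G" using i TG by auto
      have "s \<in> J" using i by (auto simp: s_def J_def)
      moreover have si: "s \<otimes>\<^bsub>G\<^esub> A.\<pi> (fst i) = fst i"
        using fi A.coset_pi_in[OF fi] by (simp add: s_def A.m_assoc)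
      then have "(A.\<pi> (fst i), snd i) \<in> Q s"
        using i A.coset_pi_in[OF fi] by (simp add: Q_def)
      ultimately show "R (fst i) (snd i)" using * si by fastforce
    qed
  qed
  have "measure (coind_space G H M) {t\<in>space (coind_space G H M). \<forall>i\<in>T. A.ev (fst i) t \<in> snd i} =
      measure (coind_space G H M)
        {t\<in>space (coind_space G H M). \<forall>s\<in>J. \<forall>(h, A)\<in>Q s. A.ev (s \<otimes>\<^bsub>G\<^esub> h) t \<in> A}"
    by (simp only: Tiff[of "\<lambda>\<gamma> A. A.ev \<gamma> _ \<in> A"])
  also have "\<dots> = (\<Prod>s\<in>J. measure M (translates_event (G\<lparr>carrier := H\<rparr>) M \<sigma> (Q s)))"
  proof (rule A.measure_ev_translates[OF J(1) JG])
    show "inj_on (\<lambda>s. s <#\<^bsub>G\<^esub> H) J"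
    proof (rule inj_onI)
      fix s s' assume s: "s \<in> J" "s' \<in> J" "s <#\<^bsub>G\<^esub> H = s' <#\<^bsub>G\<^esub> H"
      then obtain h where h: "h \<in> H" "s' = s \<otimes>\<^bsub>G\<^esub> h"
        using A.left_coset_eq_iff[OF JG JG] by blast
      have "s \<in> S" "s' \<in> S" using s J by auto
      then have "h = \<one>\<^bsub>G\<^esub>" using h A.coset_pi_rep_mult A.coset_pi_rep by metis
      then show "s = s'" using h JG[OF s(1)] by simp
    qed
  qed (use Qfin QH in auto)
  finally have mM: "measure (coind_space G H M)
      {t\<in>space (coind_space G H M). \<forall>i\<in>T. A.ev (fst i) t \<in> snd i} =
      (\<Prod>s\<in>J. measure M (translates_event (G\<lparr>carrier := H\<rparr>) M \<sigma> (Q s)))" .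
  have mult: "\<Delta> (s \<otimes>\<^bsub>G\<^esub> h) = \<Delta> s \<otimes>\<^bsub>\<Lambda>\<^esub> \<delta> h" if "s \<in> carrier G" "h \<in> H" for s h
    using that by (simp add: ext[symmetric])
  have "(\<forall>s\<in>J. \<forall>(h, A)\<in>Q s. B.ev (\<Delta> (s \<otimes>\<^bsub>G\<^esub> h)) t \<in> \<Phi> A) \<longleftrightarrow>
      (\<forall>s\<in>J. \<forall>(k, A')\<in>map_prod \<delta> \<Phi> ` Q s. B.ev (\<Delta> s \<otimes>\<^bsub>\<Lambda>\<^esub> k) t \<in> A')" for t
  proof (intro ball_cong refl)
    fix s assume s: "s \<in> J"
    have "B.ev (\<Delta> (s \<otimes>\<^bsub>G\<^esub> h)) t = B.ev (\<Delta> s \<otimes>\<^bsub>\<Lambda>\<^esub> \<delta> h) t" if "(h, A) \<in> Q s" for h A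
      using that mult[OF JG[OF s]] by (auto simp: Q_def)
    then show "(\<forall>(h, A)\<in>Q s. B.ev (\<Delta> (s \<otimes>\<^bsub>G\<^esub> h)) t \<in> \<Phi> A) \<longleftrightarrow>
        (\<forall>(k, A')\<in>map_prod \<delta> \<Phi> ` Q s. B.ev (\<Delta> s \<otimes>\<^bsub>\<Lambda>\<^esub> k) t \<in> A')"
      by fastforce
  qed
  then have "measure (coind_space \<Lambda> K N)
        {t\<in>space (coind_space \<Lambda> K N). \<forall>i\<in>T. B.ev (\<Delta> (fst i)) t \<in> \<Phi> (snd i)} =
      measure (coind_space \<Lambda> K N) {t\<in>space (coind_space \<Lambda> K N).
        \<forall>s\<in>J. \<forall>(k, A')\<in>map_prod \<delta> \<Phi> ` Q s. B.ev (\<Delta> s \<otimes>\<^bsub>\<Lambda>\<^esub> k) t \<in> A'}"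
    by (simp only: Tiff[of "\<lambda>\<gamma> A. B.ev (\<Delta> \<gamma>) _ \<in> \<Phi> A"])
  also have "\<dots> = (\<Prod>s\<in>J. measure N (translates_event (\<Lambda>\<lparr>carrier := K\<rparr>) N \<rho> (map_prod \<delta> \<Phi> ` Q s)))"
  proof (rule B.measure_ev_translates[OF J(1)])
    show "inj_on (\<lambda>s. \<Delta> s <#\<^bsub>\<Lambda>\<^esub> K) J"
    proof (rule inj_onI)
      fix s s' assume s: "s \<in> J" "s' \<in> J" "\<Delta> s <#\<^bsub>\<Lambda>\<^esub> K = \<Delta> s' <#\<^bsub>\<Lambda>\<^esub> K"
      then obtain k where k: "k \<in> K" "\<Delta> s' = \<Delta> s \<otimes>\<^bsub>\<Lambda>\<^esub> k"
        using B.left_coset_eq_iff[of "\<Delta> s" "\<Delta> s'"] JG by auto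
      then obtain h where h: "h \<in> H" "k = \<delta> h" using \<delta>H by auto
      then have "\<Delta> s' = \<Delta> (s \<otimes>\<^bsub>G\<^esub> h)" using k mult[OF JG[OF s(1)]] by simp
      then have s': "s' = s \<otimes>\<^bsub>G\<^esub> h"
        using inj_onD[OF \<Delta>_inj, of s' "s \<otimes>\<^bsub>G\<^esub> h"] JG s h by auto
      have "s \<in> S" "s' \<in> S" using s J by auto
      then have "h = \<one>\<^bsub>G\<^esub>" using h s' A.coset_pi_rep_mult A.coset_pi_rep by metis
      then show "s = s'" using s' JG[OF s(1)] by simp
    qed
    show "map_prod \<delta> \<Phi> ` Q s \<subseteq> K \<times> sets N" if "s \<in> J" for s
    proof -
      have "\<delta> h \<in> K" "\<Phi> A \<in> sets N" if "(h, A) \<in> Q s" for h A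
        using that Q[OF \<open>s \<in> J\<close>] QH[OF \<open>s \<in> J\<close>] \<delta>H \<Phi> by auto
      then show ?thesis by auto
    qed
  qed (use Qfin JG in auto)
  finally have mN: "measure (coind_space \<Lambda> K N)
      {t\<in>space (coind_space \<Lambda> K N). \<forall>i\<in>T. B.ev (\<Delta> (fst i)) t \<in> \<Phi> (snd i)} =
      (\<Prod>s\<in>J. measure N (translates_event (\<Lambda>\<lparr>carrier := K\<rparr>) N \<rho> (map_prod \<delta> \<Phi> ` Q s)))" .
  have "\<bar>(\<Prod>s\<in>J. measure M (translates_event (G\<lparr>carrier := H\<rparr>) M \<sigma> (Q s))) -
      (\<Prod>s\<in>J. measure N (translates_event (\<Lambda>\<lparr>carrier := K\<rparr>) N \<rho> (map_prod \<delta> \<Phi> ` Q s)))\<bar> \<le>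
      (\<Sum>s\<in>J. \<bar>measure M (translates_event (G\<lparr>carrier := H\<rparr>) M \<sigma> (Q s)) -
        measure N (translates_event (\<Lambda>\<lparr>carrier := K\<rparr>) N \<rho> (map_prod \<delta> \<Phi> ` Q s))\<bar>)"
    unfolding real_norm_def[symmetric] by (rule norm_prod_diff) auto
  also have "\<dots> \<le> (\<Sum>s\<in>J. \<eta>)"
    using close Q by (intro sum_mono) auto
  also have "\<dots> = real (card J) * \<eta>" by simp
  also have "\<dots> \<le> real (card E) * \<eta>"
    using cardJ close[of "{}"] by (intro mult_right_mono) auto
  finally show ?thesis unfolding mM mN .
qed

text \<open>Each given set \<open>B\<close> is approximated by a Boolean combination of conditions \<open>ev \<gamma> t \<in> A\<close>, and \<open>\<Psi> B\<close> is the
  same combination of the conditions \<open>ev (\<Delta> \<gamma>) t \<in> \<Phi> A\<close>, where \<open>\<Phi>\<close> comes from the weak embeddability of the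
  base actions. Because both actions are left translation of the index \<open>\<gamma>\<close>, an intersection of translates
  of such sets is one Boolean combination over the finite index set \<open>E'\<close> of translated conditions,
  with the same formula on both sides; the comparison of moments and of patterns applies.\<close>

lemma weakly_embeddable_coind:
  fixes G :: "('g, 'm) monoid_scheme" and \<Lambda> :: "('l, 'k) monoid_scheme"
    and M :: "'x measure" and N :: "'y measure"
  assumes cM: "coinduction_data G H S M \<sigma>" and cN: "coinduction_data \<Lambda> K S' N \<rho>"
    and weak: "weakly_embeddable (G\<lparr>carrier := H\<rparr>) M \<sigma> (\<Lambda>\<lparr>carrier := K\<rparr>) N \<rho> \<delta>"
    and \<Delta>: "\<Delta> \<in> iso G \<Lambda>" and ext: "\<And>h. h \<in> H \<Longrightarrow> \<Delta> h = \<delta> h"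
  shows "weakly_embeddable G (coind_space G H M) (coind_action G H S \<sigma>)
    \<Lambda> (coind_space \<Lambda> K N) (coind_action \<Lambda> K S' \<rho>) \<Delta>"
proof -
  interpret A: coinduction_data G H S M \<sigma> by fact
  interpret B: coinduction_data \<Lambda> K S' N \<rho> by fact
  interpret \<Delta>: group_hom G \<Lambda> \<Delta>
    using \<Delta> A.is_group B.is_group by (simp add: group_hom_def group_hom_axioms_def iso_def)
  interpret CM: prob_space A.coindM by (rule A.prob_space_coind)
  interpret CN: prob_space B.coindM by (rule B.prob_space_coind)
  have base: "\<delta> \<in> iso (G\<lparr>carrier := H\<rparr>) (\<Lambda>\<lparr>carrier := K\<rparr>)"
    "\<And>F \<A> (\<epsilon>::real). finite F \<and> F \<subseteq> carrier (G\<lparr>carrier := H\<rparr>) \<and> finite \<A> \<and> \<A> \<subseteq> sets M \<and> 0 < \<epsilon> \<Longrightarrow>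
      \<exists>\<Phi>. \<Phi> ` \<A> \<subseteq> sets N \<and> (\<forall>T \<subseteq> F \<times> \<A>.
        \<bar>measure M (translates_event (G\<lparr>carrier := H\<rparr>) M \<sigma> T) -
         measure N (translates_event (\<Lambda>\<lparr>carrier := K\<rparr>) N \<rho> (map_prod \<delta> \<Phi> ` T))\<bar> < \<epsilon>)"
    using weak weakly_embeddable_sets_iff[OF A.prob_space_base B.prob_space_base
        A.subgroup_is_group[OF A.is_group] B.subgroup_is_group[OF B.is_group]
        pmp_action_measure_preserving[OF A.pmp_base] pmp_action_measure_preserving[OF B.pmp_base]]
    by blast+
  show ?thesis
  proof (subst weakly_embeddable_sets_iff[OF A.prob_space_coind B.prob_space_coind A.is_group B.is_group
        A.coind_action_measure_preserving B.coind_action_measure_preserving],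
      intro conjI \<Delta> allI impI, elim conjE)
    fix F and \<B> :: "('g set \<Rightarrow> 'x) set set" and \<epsilon> :: real
    assume F: "finite F" "F \<subseteq> carrier G" and \<B>: "finite \<B>" "\<B> \<subseteq> sets A.coindM" and \<epsilon>: "0 < \<epsilon>"
    define c where "c = real (card (F \<times> \<B>))"
    \<comment> \<open>At most \<open>c\<close> approximations are intersected, and together they may use up \<open>\<epsilon> / 2\<close>.\<close>
    define \<epsilon>' where "\<epsilon>' = \<epsilon> / (2 * (c + 1))"
    have c: "c \<ge> 0" by (simp add: c_def)
    have \<epsilon>': "\<epsilon>' > 0" using \<epsilon> c by (simp add: \<epsilon>'_def)
    define W where "W = (\<lambda>i. {t\<in>space A.coindM. A.ev (fst i) t \<in> snd i})"
    have "\<forall>B\<in>\<B>. \<exists>E P. finite E \<and> E \<subseteq> S \<times> sets M \<and>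
        measure A.coindM (sym_diff B (pattern_event A.coindM W E P)) < \<epsilon>'"
    proof
      fix B assume "B \<in> \<B>"
      then have "B \<in> sets A.coindM" using \<B> by auto
      with CM.approximable_by_pattern_event[OF A.sets_coind_generated _ \<epsilon>']
      show "\<exists>E P. finite E \<and> E \<subseteq> S \<times> sets M \<and>
          measure A.coindM (sym_diff B (pattern_event A.coindM W E P)) < \<epsilon>'"
        unfolding W_def .
    qed
    then obtain EE PP where EE: "\<And>B. B \<in> \<B> \<Longrightarrow> finite (EE B)" "\<And>B. B \<in> \<B> \<Longrightarrow> EE B \<subseteq> S \<times> sets M"
      and approx: "\<And>B. B \<in> \<B> \<Longrightarrow>
        measure A.coindM (sym_diff B (pattern_event A.coindM W (EE B) (PP B))) < \<epsilon>'"
      by metis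
    define E where "E = (\<Union>B\<in>\<B>. EE B)"
    have "S \<times> sets M \<subseteq> carrier G \<times> sets M" using A.reps_carrier by auto
    then have E: "finite E" "E \<subseteq> carrier G \<times> sets M"
      using EE \<B> unfolding E_def by blast+
    \<comment> \<open>Taken from \<open>E\<close> and not from the translated set \<open>E'\<close>, which is empty if \<open>F\<close> is.\<close>
    define \<A> where "\<A> = snd ` E"
    have \<A>: "finite \<A>" "\<A> \<subseteq> sets M" using E by (auto simp: \<A>_def)
    define E' where "E' = (\<lambda>(g, i). (g \<otimes>\<^bsub>G\<^esub> fst i, snd i)) ` (F \<times> E)"
    have "(g \<otimes>\<^bsub>G\<^esub> fst i, snd i) \<in> carrier G \<times> \<A>" if "g \<in> F" "i \<in> E" for g i
    proof -
      have "g \<in> carrier G" "fst i \<in> carrier G" using that E F by auto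
      then show ?thesis using that by (simp add: \<A>_def)
    qed
    then have E': "finite E'" "E' \<subseteq> carrier G \<times> \<A>" using E F by (auto simp: E'_def)
    define n where "n = card E'"
    \<comment> \<open>Comparing patterns over \<open>E'\<close> costs \<open>4 ^ n\<close>, and factoring moments over cosets at most \<open>n\<close>.\<close>
    define \<eta> where "\<eta> = \<epsilon> / (2 * (4 ^ n * (real n + 1)))"
    have \<eta>: "\<eta> > 0" using \<epsilon> by (simp add: \<eta>_def)
    have "fst ` E' \<subseteq> carrier G" using E' by auto
    then have "finite (A.\<pi> ` fst ` E') \<and> A.\<pi> ` fst ` E' \<subseteq> carrier (G\<lparr>carrier := H\<rparr>) \<and>
        finite \<A> \<and> \<A> \<subseteq> sets M \<and> 0 < \<eta>"
      using E' \<A> \<eta> A.coset_pi_in by auto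
    from base(2)[OF this] obtain \<Phi> where \<Phi>: "\<Phi> ` \<A> \<subseteq> sets N"
      and close: "\<And>T. T \<subseteq> (A.\<pi> ` fst ` E') \<times> \<A> \<Longrightarrow>
        \<bar>measure M (translates_event (G\<lparr>carrier := H\<rparr>) M \<sigma> T) -
         measure N (translates_event (\<Lambda>\<lparr>carrier := K\<rparr>) N \<rho> (map_prod \<delta> \<Phi> ` T))\<bar> < \<eta>"
      by (elim exE conjE) (rule that, auto)
    define V where "V = (\<lambda>i. {t\<in>space B.coindM. B.ev (\<Delta> (fst i)) t \<in> \<Phi> (snd i)})"
    have W_sets: "W i \<in> sets A.coindM" if "i \<in> carrier G \<times> \<A>" for i
    proof -
      have "A.ev (fst i) -` snd i \<inter> space A.coindM \<in> sets A.coindM"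
        using that \<A> by (intro measurable_sets[OF A.ev_measurable]) auto
      then show ?thesis by (simp add: W_def vimage_def Int_def conj_commute)
    qed
    have V_sets: "V i \<in> sets B.coindM" if "i \<in> carrier G \<times> \<A>" for i
    proof -
      have "B.ev (\<Delta> (fst i)) -` \<Phi> (snd i) \<inter> space B.coindM \<in> sets B.coindM"
        using that \<Phi> by (intro measurable_sets[OF B.ev_measurable]) auto
      then show ?thesis by (simp add: V_def vimage_def Int_def conj_commute)
    qed
    have EE_sub: "EE B \<subseteq> carrier G \<times> \<A>" if "B \<in> \<B>" for B
    proof -
      have "E \<subseteq> carrier G \<times> \<A>" using E by (force simp: \<A>_def)
      then show ?thesis using that unfolding E_def by blast
    qed
    define \<Psi> where "\<Psi> B = pattern_event B.coindM V (EE B) (PP B)" for B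
    \<comment> \<open>The common formula: which patterns over \<open>E'\<close> belong to the intersection of the translates in \<open>T\<close>.\<close>
    define R where "R T Z \<longleftrightarrow> (\<forall>(g, B)\<in>T. PP B {i\<in>EE B. (g \<otimes>\<^bsub>G\<^esub> fst i, snd i) \<in> Z})" for T Z
    have \<Psi>: "\<Psi> ` \<B> \<subseteq> sets B.coindM"
      unfolding \<Psi>_def image_subset_iff
      using EE(1) EE_sub V_sets by (intro ballI sets_pattern_event) blast+
    have hits: "{i\<in>EE B. (g \<otimes>\<^bsub>G\<^esub> fst i, snd i) \<in> {i\<in>E'. Q i}} = {i\<in>EE B. Q (g \<otimes>\<^bsub>G\<^esub> fst i, snd i)}"
      if "g \<in> F" "B \<in> \<B>" for g B and Q
      using that by (force simp: E'_def E_def)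
    have "\<bar>measure A.coindM (translates_event G A.coindM A.coind\<sigma> T) -
        measure B.coindM (translates_event \<Lambda> B.coindM B.coind\<sigma> (map_prod \<Delta> \<Psi> ` T))\<bar> < \<epsilon>"
      if T: "T \<subseteq> F \<times> \<B>" for T
    proof -
      have finT: "finite T" using T F \<B> by (meson finite_SigmaI finite_subset)
      have gG: "g \<in> carrier G" "B \<in> \<B>" "g \<in> F" if "(g, B) \<in> T" for g B using that T F by auto
      let ?pat = "\<lambda>B. pattern_event A.coindM W (EE B) (PP B)"
      let ?X = "translates_event G A.coindM A.coind\<sigma> T"
      let ?Y = "pattern_event A.coindM W E' (R T)"
      have iffA: "t \<in> ?Y \<longleftrightarrow> (\<forall>(g, B)\<in>T. A.coind\<sigma> (inv\<^bsub>G\<^esub> g) t \<in> ?pat B)"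
        if t: "t \<in> space A.coindM" for t
      proof -
        have "A.coind\<sigma> (inv\<^bsub>G\<^esub> g) t \<in> ?pat B \<longleftrightarrow>
            PP B {i\<in>EE B. (g \<otimes>\<^bsub>G\<^esub> fst i, snd i) \<in> {i\<in>E'. t \<in> W i}}" if "(g, B) \<in> T" for g B
        proof -
          have "A.coind\<sigma> (inv\<^bsub>G\<^esub> g) t \<in> ?pat B \<longleftrightarrow>
              PP B {i\<in>EE B. A.ev (g \<otimes>\<^bsub>G\<^esub> fst i) t \<in> snd i}"
            unfolding W_def using gG[OF that] EE_sub[OF gG(2)[OF that]] t
            by (intro A.coind_action_pattern_event) auto
          also have "{i\<in>EE B. A.ev (g \<otimes>\<^bsub>G\<^esub> fst i) t \<in> snd i} =
              {i\<in>EE B. t \<in> W (g \<otimes>\<^bsub>G\<^esub> fst i, snd i)}"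
            using t by (simp add: W_def)
          finally show ?thesis unfolding hits[OF gG(3,2)[OF that]] .
        qed
        then show ?thesis
          using t by (auto simp: pattern_event_def[of _ _ E'] R_def)
      qed
      have iffB: "translates_event \<Lambda> B.coindM B.coind\<sigma> (map_prod \<Delta> \<Psi> ` T) =
          pattern_event B.coindM V E' (R T)"
      proof -
        have "B.coind\<sigma> (inv\<^bsub>\<Lambda>\<^esub> \<Delta> g) t \<in> \<Psi> B \<longleftrightarrow>
            PP B {i\<in>EE B. (g \<otimes>\<^bsub>G\<^esub> fst i, snd i) \<in> {i\<in>E'. t \<in> V i}}"
          if "(g, B) \<in> T" and t: "t \<in> space B.coindM" for g B t
        proof -
          have "B.coind\<sigma> (inv\<^bsub>\<Lambda>\<^esub> \<Delta> g) t \<in> \<Psi> B \<longleftrightarrow>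
              PP B {i\<in>EE B. B.ev (\<Delta> g \<otimes>\<^bsub>\<Lambda>\<^esub> \<Delta> (fst i)) t \<in> \<Phi> (snd i)}"
            unfolding \<Psi>_def V_def
            using gG[OF that(1)] EE_sub[OF gG(2)[OF that(1)]] t
            by (intro B.coind_action_pattern_event) auto
          also have "{i\<in>EE B. B.ev (\<Delta> g \<otimes>\<^bsub>\<Lambda>\<^esub> \<Delta> (fst i)) t \<in> \<Phi> (snd i)} =
              {i\<in>EE B. t \<in> V (g \<otimes>\<^bsub>G\<^esub> fst i, snd i)}"
            using gG[OF that(1)] EE_sub[OF gG(2)[OF that(1)]] t by (auto simp: V_def)
          finally show ?thesis unfolding hits[OF gG(3,2)[OF that(1)]] .
        qed
        then show ?thesis
          by (fastforce simp: translates_event_def pattern_event_def R_def)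
      qed
      have pat_sets: "?pat B \<in> sets A.coindM" if "B \<in> \<B>" for B
        using EE(1)[OF that] EE_sub[OF that] W_sets by (intro sets_pattern_event) blast+
      have X: "?X \<in> sets A.coindM"
        using finT T F \<B> by (intro sets_translates_event[OF A.is_group A.coind_action_measure_preserving]) auto
      have Y: "?Y \<in> sets A.coindM"
        using E' W_sets by (intro sets_pattern_event) blast+
      define D where "D = (\<lambda>(g, B). A.coind\<sigma> (inv\<^bsub>G\<^esub> g) -` sym_diff B (?pat B) \<inter> space A.coindM)"
      have D: "D y \<in> sets A.coindM" "measure A.coindM (D y) \<le> \<epsilon>'" if yT: "y \<in> T" for y
      proof -
        obtain g B where y: "y = (g, B)" by (cases y)
        have B: "B \<in> \<B>" and g: "inv\<^bsub>G\<^esub> g \<in> carrier G" using gG yT y by auto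
        have SB: "sym_diff B (?pat B) \<in> sets A.coindM" using pat_sets[OF B] B \<B> by auto
        note mp = measure_preserving_mapsD[OF A.coind_action_measure_preserving g]
        show "D y \<in> sets A.coindM" unfolding D_def y using measurable_sets[OF mp(1) SB] by simp
        have "measure A.coindM (D y) = measure A.coindM (sym_diff B (?pat B))"
          using measure_distr[OF mp(1) SB] unfolding mp(2) by (simp add: D_def y)
        then show "measure A.coindM (D y) \<le> \<epsilon>'" using approx[OF B] by simp
      qed
      have "\<bar>measure A.coindM ?X - measure A.coindM ?Y\<bar> \<le> measure A.coindM (sym_diff ?X ?Y)"
        by (rule CM.abs_measure_diff_le_sym_diff[OF X Y])
      also have "\<dots> \<le> measure A.coindM (\<Union>y\<in>T. D y)"
      proof (rule CM.finite_measure_mono)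
        show "sym_diff ?X ?Y \<subseteq> (\<Union>y\<in>T. D y)"
        proof
          fix t assume t: "t \<in> sym_diff ?X ?Y"
          then have sp: "t \<in> space A.coindM" by (auto simp: translates_event_def pattern_event_def)
          have "(\<forall>(g, B)\<in>T. A.coind\<sigma> (inv\<^bsub>G\<^esub> g) t \<in> B) \<noteq>
              (\<forall>(g, B)\<in>T. A.coind\<sigma> (inv\<^bsub>G\<^esub> g) t \<in> ?pat B)"
            using t sp iffA[OF sp] by (auto simp: translates_event_def)
          then obtain g B where "(g, B) \<in> T" "A.coind\<sigma> (inv\<^bsub>G\<^esub> g) t \<in> sym_diff B (?pat B)"
            by blast
          then show "t \<in> (\<Union>y\<in>T. D y)" using sp by (auto simp: D_def intro!: bexI[of _ "(g, B)"])
        qed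
        show "(\<Union>y\<in>T. D y) \<in> sets A.coindM" using finT D(1) by auto
      qed
      also have "\<dots> \<le> (\<Sum>y\<in>T. measure A.coindM (D y))"
        using finT D(1) by (intro CM.finite_measure_subadditive_finite) auto
      also have "\<dots> \<le> (\<Sum>y\<in>T. \<epsilon>')" using D(2) by (rule sum_mono)
      also have "\<dots> = real (card T) * \<epsilon>'" by simp
      also have "\<dots> \<le> c * \<epsilon>'"
        using T F \<B> \<epsilon>' unfolding c_def by (intro mult_right_mono of_nat_mono card_mono) auto
      also have "\<dots> < \<epsilon> / 2" using \<epsilon> c by (simp add: \<epsilon>'_def field_simps)
      finally have 1: "\<bar>measure A.coindM ?X - measure A.coindM ?Y\<bar> < \<epsilon> / 2" .
      have "\<bar>measure A.coindM ?Y - measure B.coindM (pattern_event B.coindM V E' (R T))\<bar> \<le>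
          4 ^ card E' * (real (card E') * \<eta>)"
      proof (rule pattern_event_measure_diff_le)
        show "finite_measure A.coindM" "finite_measure B.coindM" by unfold_locales
        show "finite E'" by (rule E'(1))
        show "W i \<in> sets A.coindM" "V i \<in> sets B.coindM" if "i \<in> E'" for i
          using that E' W_sets V_sets by auto
        fix T' assume T': "T' \<subseteq> E'"
        have "{t\<in>space A.coindM. \<forall>i\<in>T'. t \<in> W i} = {t\<in>space A.coindM. \<forall>i\<in>T'. A.ev (fst i) t \<in> snd i}"
          "{t\<in>space B.coindM. \<forall>i\<in>T'. t \<in> V i} =
            {t\<in>space B.coindM. \<forall>i\<in>T'. B.ev (\<Delta> (fst i)) t \<in> \<Phi> (snd i)}"
          by (auto simp: W_def V_def)
        then show "\<bar>measure A.coindM {t\<in>space A.coindM. \<forall>i\<in>T'. t \<in> W i} -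
            measure B.coindM {t\<in>space B.coindM. \<forall>i\<in>T'. t \<in> V i}\<bar> \<le> real (card E') * \<eta>"
          using evaluation_moment_diff_le[OF cM cN \<Delta> base(1) ext E' \<A>(2) \<Phi> less_imp_le[OF close] T']
          by simp
      qed
      also have "\<dots> < \<epsilon> / 2"
      proof -
        have "4 ^ n * (real n * \<eta>) < 4 ^ n * ((real n + 1) * \<eta>)"
          using \<eta> by (intro mult_strict_left_mono) auto
        also have "\<dots> = \<epsilon> / 2"
        proof -
          have "x * (y * (\<epsilon> / (2 * (x * y)))) = \<epsilon> / 2" if "x \<noteq> 0" "y \<noteq> 0" for x y :: real
            using that by (simp add: field_simps)
          then show ?thesis unfolding \<eta>_def by simp
        qed
        finally show ?thesis by (simp add: n_def)
      qed
      finally show ?thesis using 1 unfolding iffB by linarith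
    qed
    with \<Psi> show "\<exists>\<Psi>. \<Psi> ` \<B> \<subseteq> sets B.coindM \<and> (\<forall>T \<subseteq> F \<times> \<B>.
        \<bar>measure A.coindM (translates_event G A.coindM A.coind\<sigma> T) -
         measure B.coindM (translates_event \<Lambda> B.coindM B.coind\<sigma> (map_prod \<Delta> \<Psi> ` T))\<bar> < \<epsilon>)"
      by blast
  qed
qed

theorem proposition3p8:
  fixes \<Gamma> :: "('g, 'm) monoid_scheme" and H :: "'g set"
    and X1 :: "'x measure" and X2 :: "'y measure"
    and \<sigma>1 :: "'g \<Rightarrow> 'x \<Rightarrow> 'x" and \<sigma>2 :: "'g \<Rightarrow> 'y \<Rightarrow> 'y"
    and S1 S2 :: "'g set" and \<delta> \<Delta> :: "'g \<Rightarrow> 'g"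
  assumes "Group.group \<Gamma>" and "countable (carrier \<Gamma>)"
    and "subgroup H \<Gamma>" and "infinite H"
    and "standard_prob_space X1" and "standard_prob_space X2"
    and "pmp_action (\<Gamma>\<lparr>carrier := H\<rparr>) X1 \<sigma>1" and "pmp_action (\<Gamma>\<lparr>carrier := H\<rparr>) X2 \<sigma>2"
    and "free_action (\<Gamma>\<lparr>carrier := H\<rparr>) X1 \<sigma>1" and "free_action (\<Gamma>\<lparr>carrier := H\<rparr>) X2 \<sigma>2"
    and "ergodic_action (\<Gamma>\<lparr>carrier := H\<rparr>) X1 \<sigma>1" and "ergodic_action (\<Gamma>\<lparr>carrier := H\<rparr>) X2 \<sigma>2"
    and "coset_reps \<Gamma> H S1" and "coset_reps \<Gamma> H S2"
    and "weakly_conjugate (\<Gamma>\<lparr>carrier := H\<rparr>) X1 \<sigma>1 (\<Gamma>\<lparr>carrier := H\<rparr>) X2 \<sigma>2 \<delta>"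
    and "\<Delta> \<in> iso \<Gamma> \<Gamma>" and "\<forall>h\<in>H. \<Delta> h = \<delta> h"
  shows "weakly_conjugate \<Gamma> (coind_space \<Gamma> H X1) (coind_action \<Gamma> H S1 \<sigma>1)
                          \<Gamma> (coind_space \<Gamma> H X2) (coind_action \<Gamma> H S2 \<sigma>2) \<Delta>"
proof -
  have c1: "coinduction_data \<Gamma> H S1 X1 \<sigma>1" and c2: "coinduction_data \<Gamma> H S2 X2 \<sigma>2"
    using assms by (simp_all add: coinduction_data_def coinduction_data_axioms_def standard_prob_space_def)
  have w1: "weakly_embeddable (\<Gamma>\<lparr>carrier := H\<rparr>) X1 \<sigma>1 (\<Gamma>\<lparr>carrier := H\<rparr>) X2 \<sigma>2 \<delta>"
    and w2: "weakly_embeddable (\<Gamma>\<lparr>carrier := H\<rparr>) X2 \<sigma>2 (\<Gamma>\<lparr>carrier := H\<rparr>) X1 \<sigma>1 (inv_into H \<delta>)"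
    using assms(15) by (simp_all add: weakly_conjugate_def)
  have \<delta>: "bij_betw \<delta> H H"
    using w1 by (simp add: weakly_embeddable_def iso_def)
  \<comment> \<open>The hypotheses are symmetric: the inverse of \<open>\<Delta>\<close> extends the inverse of \<open>\<delta>\<close>.\<close>
  have \<Delta>inv: "inv_into (carrier \<Gamma>) \<Delta> \<in> iso \<Gamma> \<Gamma>"
    using group.iso_set_sym[OF assms(1)] assms(16) by blast
  have "inv_into (carrier \<Gamma>) \<Delta> h = inv_into H \<delta> h" if h: "h \<in> H" for h
  proof -
    have k: "inv_into H \<delta> h \<in> H" "\<delta> (inv_into H \<delta> h) = h"
      using \<delta> h by (auto simp: bij_betw_def inv_into_into f_inv_into_f)
    have "inj_on \<Delta> (carrier \<Gamma>)" using assms(16) by (simp add: iso_def bij_betw_def)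
    moreover have "inv_into H \<delta> h \<in> carrier \<Gamma>" using k subgroup.subset[OF assms(3)] by auto
    ultimately show ?thesis using inv_into_f_f[of \<Delta> "carrier \<Gamma>" "inv_into H \<delta> h"] k assms(17) by simp
  qed
  then show ?thesis
    unfolding weakly_conjugate_def
    using weakly_embeddable_coind[OF c1 c2 w1 assms(16)] weakly_embeddable_coind[OF c2 c1 w2 \<Delta>inv] assms(17)
    by blast
qed

end
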